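(* Let $n\ge 2$ and let $B=B(x_0,R)$ be an open ball in $\mathbb{R}^n$. Let $\psi\in C_0^\infty(\mathbb{R}^n)$ satisfy $\operatorname{supp}\psi\subseteq B$ and $\int_{\mathbb{R}^n}\psi=1$. Let $\Omega\subset\mathbb{R}^n$ be a bounded open set which is star-shaped with respect to every point of $\overline{B}$. Then for every $F\in C_D(\Omega)$ with $\int_\Omega F=0$, the formula $$v(x)=\int_\Omega F(y)\left[\frac{x-y}{|x-y|^n}\int_{|x-y|}^{+\infty}\psi\Big(y+\xi\frac{x-y}{|x-y|}\Big)\xi^{n-1}\,d\xi\right]dy,\qquad x\in\mathbb{R}^n,$$ defines a function $v\in C^1(\Omega)\cap C^0(\mathbb{R}^n)$ satisfying $\operatorname{div} v(x)=F(x)$ for all $x\in\Omega$ and $v\equiv 0$ on $\mathbb{R}^n\setminus\Omega$.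
   Context: $\Omega$ is star-shaped with respect to a point $p$ if $p\in\Omega$ and for every $y\in\Omega$ the segment joining $p$ and $y$ lies in $\Omega$. For a function $F$ on $\Omega$, $\omega(F,\rho)=\sup_{x,y\in\Omega,\ |x-y|<\rho}|F(x)-F(y)|$; $C_D(\Omega)$ is the space of functions $F$ on $\Omega$ such that $\omega(F,\rho)/\rho$ is integrable near $0^+$ (uniformly Dini-continuous functions). *)

theory Defs
  imports "HOL-Analysis.Analysis"
begin

definition partial_deriv :: "'n::finite \<Rightarrow> (real^'n \<Rightarrow> real) \<Rightarrow> (real^'n \<Rightarrow> real)" where
  "partial_deriv i f = (\<lambda>x. frechet_derivative f (at x) (axis i 1))"

fun iter_partial :: "'n::finite list \<Rightarrow> (real^'n \<Rightarrow> real) \<Rightarrow> (real^'n \<Rightarrow> real)" where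
  "iter_partial [] f = f"
| "iter_partial (i # is) f = partial_deriv i (iter_partial is f)"

text \<open>C-infinity on all of R^n: every iterated partial derivative exists and is
  differentiable everywhere (hence all partial derivatives of all orders are continuous).\<close>
definition smooth_Rn :: "(real^'n::finite \<Rightarrow> real) \<Rightarrow> bool" where
  "smooth_Rn f \<longleftrightarrow> (\<forall>is. iter_partial is f differentiable_on UNIV)"

definition tsupp :: "(real^'n::finite \<Rightarrow> real) \<Rightarrow> (real^'n) set" where
  "tsupp f = closure {x. f x \<noteq> 0}"

definition star_shaped_wrt :: "(real^'n::finite) set \<Rightarrow> real^'n \<Rightarrow> bool" where
  "star_shaped_wrt \<Omega> p \<longleftrightarrow> p \<in> \<Omega> \<and> (\<forall>y\<in>\<Omega>. closed_segment p y \<subseteq> \<Omega>)"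

definition modulus :: "(real^'n::finite) set \<Rightarrow> (real^'n \<Rightarrow> real) \<Rightarrow> real \<Rightarrow> real" where
  "modulus \<Omega> F \<rho> = Sup {\<bar>F x - F y\<bar> | x y. x \<in> \<Omega> \<and> y \<in> \<Omega> \<and> dist x y < \<rho>}"

definition dini_continuous :: "(real^'n::finite) set \<Rightarrow> (real^'n \<Rightarrow> real) \<Rightarrow> bool" where
  "dini_continuous \<Omega> F \<longleftrightarrow> (\<exists>\<delta>>0.
      bdd_above {\<bar>F x - F y\<bar> | x y. x \<in> \<Omega> \<and> y \<in> \<Omega> \<and> dist x y < \<delta>} \<and>
      (\<lambda>\<rho>. modulus \<Omega> F \<rho> / \<rho>) integrable_on {0<..\<delta>})"

definition divergence :: "(real^'n::finite \<Rightarrow> real^'n) \<Rightarrow> real^'n \<Rightarrow> real" where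
  "divergence v x = (\<Sum>i\<in>UNIV. frechet_derivative v (at x) (axis i 1) $ i)"

end

theory Submission
  imports Defs
begin

text \<open>
  Substituting \<open>\<xi> = |x - y| (1 + t)\<close> and exchanging the integrals gives \<open>v(x) = \<integral>\<^sub>0\<^sup>\<infinity> U\<^sub>t(x) dt\<close> with
  \<open>U\<^sub>t(x) = (1 + t)\<^sup>n\<^sup>-\<^sup>1 \<integral> F(y) (x - y) \<psi>(x + t(x - y)) dy\<close>, where \<open>F\<close> is extended by \<open>0\<close>. On the support
  of the integrand \<open>|x - y| \<le> C/(1 + t)\<close>, so \<open>U\<^sub>t = O(t\<^sup>-\<^sup>2)\<close>. For fixed \<open>t\<close> there is no singularity, and
  \<open>\<nabla>U\<^sub>t\<close> is \<open>O(t\<^sup>-\<^sup>2)\<close> plus a term whose kernel is a \<open>y\<close>-gradient. That kernel has mean zero,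
  so one may replace \<open>F(y)\<close> by \<open>F(y) - F(x)\<close>, which bounds this term by \<open>C \<omega>(F, M/t)/t\<close>; the Dini condition says
  exactly that this is integrable near \<open>t = \<infinity>\<close>. Hence \<open>v\<close> is \<open>C\<^sup>1\<close>. Finally \<open>div U\<^sub>t\<close> is the
  \<open>t\<close>-derivative of \<open>A\<^sub>t(x) = (1 + t)\<^sup>n \<integral> F(y) \<psi>(x + t(x - y)) dy\<close>, which runs from
  \<open>A\<^sub>0(x) = \<psi>(x) \<integral> F = 0\<close> to \<open>A\<^sub>\<infinity>(x) = F(x)\<close>.
\<close>

section \<open>Integrals depending on a parameter\<close>

text \<open>The mean value inequality on the ball bounds the difference quotients by
  \<open>g\<close>, so the remainder divided by \<open>norm h\<close> is at most
  \<open>2 * g\<close>, and dominated convergence applies along every sequence tending to 0. Writing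
  the derivative as an inner product with \<open>f'\<close> makes the gradient itself a Bochner
  integral.\<close>

lemma has_gradient_integral:
  fixes f :: "'x::euclidean_space \<Rightarrow> 'a \<Rightarrow> real" and f' :: "'x \<Rightarrow> 'a \<Rightarrow> 'x"
  assumes e: "e > 0"
    and int: "\<And>z. z \<in> ball x e \<Longrightarrow> integrable M (f z)"
    and der: "\<And>z a. z \<in> ball x e \<Longrightarrow> a \<in> space M \<Longrightarrow> ((\<lambda>z. f z a) has_derivative (\<lambda>h. h \<bullet> f' z a)) (at z)"
    and meas: "f' x \<in> borel_measurable M"
    and g: "integrable M g"
    and bd: "\<And>z a. z \<in> ball x e \<Longrightarrow> a \<in> space M \<Longrightarrow> norm (f' z a) \<le> g a"
  shows "((\<lambda>z. integral\<^sup>L M (f z)) has_derivative (\<lambda>h. h \<bullet> integral\<^sup>L M (f' x))) (at x)"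
proof -
  have x: "x \<in> ball x e" using e by simp
  have int': "integrable M (f' x)"
  proof (rule Bochner_Integration.integrable_bound[OF g meas])
    show "AE a in M. norm (f' x a) \<le> norm (g a)"
      using bd[OF x] by (intro AE_I2) (smt (verit) real_norm_def)
  qed
  have mvt: "\<bar>f z a - f x a\<bar> \<le> g a * norm (z - x)" if z: "z \<in> ball x e" and a: "a \<in> space M" for z a
  proof -
    have "norm (f z a - f x a) \<le> g a * norm (z - x)"
    proof (rule differentiable_bound[of "ball x e" _ "\<lambda>z h. h \<bullet> f' z a"])
      fix w assume w: "w \<in> ball x e"
      show "((\<lambda>z. f z a) has_derivative (\<lambda>h. h \<bullet> f' w a)) (at w within ball x e)"
        using der[OF w a] has_derivative_at_withinI by blast
      show "onorm (\<lambda>h. h \<bullet> f' w a) \<le> g a"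
      proof (rule onorm_le)
        fix h
        have "norm (h \<bullet> f' w a) \<le> norm h * norm (f' w a)" by (simp add: Cauchy_Schwarz_ineq2)
        also have "\<dots> \<le> norm h * g a" using bd[OF w a] by (simp add: mult_left_mono)
        finally show "norm (h \<bullet> f' w a) \<le> g a * norm h" by (simp add: mult.commute)
      qed
    qed (use z x in auto)
    then show ?thesis by simp
  qed
  show ?thesis
    unfolding has_derivative_at
  proof (intro conjI)
    show "bounded_linear (\<lambda>h. h \<bullet> integral\<^sup>L M (f' x))" by (rule bounded_linear_inner_left)
    let ?q = "\<lambda>h. norm (integral\<^sup>L M (f (x + h)) - integral\<^sup>L M (f x) - h \<bullet> integral\<^sup>L M (f' x)) / norm h"
    show "(?q \<longlongrightarrow> 0) (at 0)"
      unfolding tendsto_at_iff_sequentially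
    proof (intro allI impI)
      fix X :: "nat \<Rightarrow> 'x" assume X0: "\<forall>i. X i \<in> UNIV - {0}" and X: "X \<longlonglongrightarrow> 0"
      have "\<forall>\<^sub>F i in sequentially. dist (X i) 0 < e" using X e tendstoD by blast
      then obtain N where N: "\<And>i. i \<ge> N \<Longrightarrow> norm (X i) < e"
        by (auto simp: eventually_sequentially)
      \<comment> \<open>The bounds hold only inside the ball, which \<open>X\<close> is known to
        reach from index \<open>N\<close> on; the shift is undone at the end.\<close>
      define Y where "Y i = X (i + N)" for i
      have Y0: "Y i \<noteq> 0" and Ye: "norm (Y i) < e" for i using X0 N by (auto simp: Y_def)
      have Y: "Y \<longlonglongrightarrow> 0" unfolding Y_def using X by (rule LIMSEQ_ignore_initial_segment)
      have Yb: "x + Y i \<in> ball x e" for i using Ye[of i] by (simp add: dist_norm)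
      define s where "s i a = (f (x + Y i) a - f x a - Y i \<bullet> f' x a) / norm (Y i)" for i a
      have "(\<lambda>i. integral\<^sup>L M (s i)) \<longlonglongrightarrow> integral\<^sup>L M (\<lambda>a. 0)"
      proof (rule integral_dominated_convergence[where w = "\<lambda>a. 2 * g a"])
        show "integrable M (\<lambda>a. 2 * g a)" using g by simp
        show "s i \<in> borel_measurable M" for i
          unfolding s_def using int[OF Yb[of i]] int[OF x] meas by measurable
        show "AE a in M. (\<lambda>i. s i a) \<longlonglongrightarrow> 0"
        proof (rule AE_I2)
          fix a assume a: "a \<in> space M"
          have "((\<lambda>h. norm (f (x + h) a - f x a - h \<bullet> f' x a) / norm h) \<longlongrightarrow> 0) (at 0)"
            using der[OF x a] unfolding has_derivative_at by blast
          then have "(\<lambda>i. norm (f (x + Y i) a - f x a - Y i \<bullet> f' x a) / norm (Y i)) \<longlonglongrightarrow> 0"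
            using Y Y0 by (auto simp: tendsto_at_iff_sequentially o_def)
          then have "(\<lambda>i. norm (s i a)) \<longlonglongrightarrow> 0" by (simp add: s_def)
          then show "(\<lambda>i. s i a) \<longlonglongrightarrow> 0" by (rule tendsto_norm_zero_cancel)
        qed
        show "AE a in M. norm (s i a) \<le> 2 * g a" for i
        proof (rule AE_I2)
          fix a assume a: "a \<in> space M"
          have "\<bar>f (x + Y i) a - f x a\<bar> \<le> g a * norm (Y i)" using mvt[OF Yb[of i] a] by simp
          moreover have "\<bar>Y i \<bullet> f' x a\<bar> \<le> norm (Y i) * g a"
            using Cauchy_Schwarz_ineq2[of "Y i" "f' x a"] bd[OF x a]
            by (meson mult_left_mono norm_ge_zero order_trans)
          ultimately have "\<bar>f (x + Y i) a - f x a - Y i \<bullet> f' x a\<bar> \<le> 2 * g a * norm (Y i)"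
            using mult.commute[of "norm (Y i)" "g a"] by (simp only: mult.assoc)
          then show "norm (s i a) \<le> 2 * g a"
            unfolding s_def using Y0[of i] by (simp add: divide_le_eq)
        qed
      qed simp
      moreover have "integral\<^sup>L M (s i) = (integral\<^sup>L M (f (x + Y i)) - integral\<^sup>L M (f x) - Y i \<bullet> integral\<^sup>L M (f' x)) / norm (Y i)" for i
        unfolding s_def using int[OF Yb[of i]] int[OF x] int'
        by (simp add: Bochner_Integration.integral_diff)
      ultimately have "(\<lambda>i. norm ((integral\<^sup>L M (f (x + Y i)) - integral\<^sup>L M (f x) - Y i \<bullet> integral\<^sup>L M (f' x)) / norm (Y i))) \<longlonglongrightarrow> 0"
        by (intro tendsto_norm_zero) simp
      then have "(\<lambda>i. (?q \<circ> X) (i + N)) \<longlonglongrightarrow> 0" by (simp add: Y_def o_def)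
      then show "(?q \<circ> X) \<longlonglongrightarrow> 0" by (rule LIMSEQ_offset)
    qed
  qed
qed

text \<open>The majorant may depend on the neighbourhood, because the one found later for
  \<open>G\<close> depends on how far the point is from the complement of the domain.\<close>

lemma continuous_on_integral_dominated:
  fixes f :: "'x::first_countable_topology \<Rightarrow> 'a \<Rightarrow> 'b::{banach, second_countable_topology}"
  assumes S: "open S"
    and cont: "\<And>a. a \<in> space M \<Longrightarrow> continuous_on S (\<lambda>x. f x a)"
    and meas: "\<And>x. x \<in> S \<Longrightarrow> f x \<in> borel_measurable M"
    and dom: "\<And>x. x \<in> S \<Longrightarrow> \<exists>T g. open T \<and> x \<in> T \<and> integrable M g \<and> (\<forall>z\<in>T \<inter> S. \<forall>a\<in>space M. norm (f z a) \<le> g a)"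
  shows "continuous_on S (\<lambda>x. integral\<^sup>L M (f x))"
  unfolding continuous_on_def
proof
  fix x assume x: "x \<in> S"
  obtain T g where T: "open T" "x \<in> T" and g: "integrable M g"
    and b: "\<And>z a. z \<in> T \<Longrightarrow> z \<in> S \<Longrightarrow> a \<in> space M \<Longrightarrow> norm (f z a) \<le> g a"
    using dom[OF x] by blast
  show "((\<lambda>x. integral\<^sup>L M (f x)) \<longlongrightarrow> integral\<^sup>L M (f x)) (at x within S)"
    unfolding tendsto_at_iff_sequentially
  proof (intro allI impI)
    fix X assume XS: "\<forall>i. X i \<in> S - {x}" and X: "X \<longlonglongrightarrow> x"
    obtain N where N: "\<And>i. i \<ge> N \<Longrightarrow> X i \<in> T"
      using topological_tendstoD[OF X T] by (auto simp: eventually_sequentially)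
    define Y where "Y i = X (i + N)" for i
    have YT: "Y i \<in> T" and YS: "Y i \<in> S" for i using XS N by (auto simp: Y_def)
    have Y: "Y \<longlonglongrightarrow> x" unfolding Y_def using X by (rule LIMSEQ_ignore_initial_segment)
    have "(\<lambda>i. integral\<^sup>L M (f (Y i))) \<longlonglongrightarrow> integral\<^sup>L M (f x)"
    proof (rule integral_dominated_convergence[OF meas[OF x] meas[OF YS] g])
      show "AE a in M. (\<lambda>i. f (Y i) a) \<longlonglongrightarrow> f x a"
        using continuous_on_tendsto_compose[OF cont Y x] YS by auto
      show "AE a in M. norm (f (Y i) a) \<le> g a" for i using b YT YS by auto
    qed
    then have "(\<lambda>i. ((\<lambda>x. integral\<^sup>L M (f x)) \<circ> X) (i + N)) \<longlonglongrightarrow> integral\<^sup>L M (f x)"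
      by (simp add: Y_def o_def)
    then show "((\<lambda>x. integral\<^sup>L M (f x)) \<circ> X) \<longlonglongrightarrow> integral\<^sup>L M (f x)" by (rule LIMSEQ_offset)
  qed
qed

text \<open>Supremum times volume of the support. Applied with \<open>\<rho>\<close> of order
  \<open>1 / (1 + t)\<close> or \<open>1 / t\<close>, the power of \<open>\<rho>\<close> supplies
  the decay in \<open>t\<close> that balances the weight of the kernels. The bound for the integral
  of the norm serves Fubini.\<close>

lemma integral_support_bound:
  fixes f :: "'x::euclidean_space \<Rightarrow> 'b::{banach, second_countable_topology}"
  assumes meas: "f \<in> borel_measurable borel"
    and bd: "\<And>y. norm (f y) \<le> C" and supp: "\<And>y. f y \<noteq> 0 \<Longrightarrow> dist x y < \<rho>" and r: "\<rho> \<ge> 0"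
  shows "integrable lborel f"
    and "(\<integral>y. norm (f y) \<partial>lborel) \<le> C * (unit_ball_vol DIM('x) * \<rho> ^ DIM('x))"
    and "norm (integral\<^sup>L lborel f) \<le> C * (unit_ball_vol DIM('x) * \<rho> ^ DIM('x))"
proof -
  have i: "integrable lborel (\<lambda>y. C * indicator (ball x \<rho>) y)"
    by (intro integrable_mult_right integrable_real_indicator emeasure_bounded_finite) auto
  have le: "norm (f y) \<le> C * indicator (ball x \<rho>) y" for y
    using bd[of y] supp[of y] by (cases "f y = 0") (auto simp: indicator_def, (smt (verit) norm_zero)?)
  show 1: "integrable lborel f"
    by (rule Bochner_Integration.integrable_bound[OF i])
      (use meas le in \<open>auto intro!: AE_I2 order_trans[OF le]\<close>)
  have "(\<integral>y. norm (f y) \<partial>lborel) \<le> (\<integral>y. C * indicator (ball x \<rho>) y \<partial>lborel)"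
    by (rule integral_mono[OF integrable_norm[OF 1] i le])
  also have "\<dots> = C * measure lborel (ball x \<rho>)" by simp
  also have "\<dots> = C * (unit_ball_vol DIM('x) * \<rho> ^ DIM('x))"
    using content_ball[OF r, of x] by simp
  finally show 2: "(\<integral>y. norm (f y) \<partial>lborel) \<le> C * (unit_ball_vol DIM('x) * \<rho> ^ DIM('x))" .
  show "norm (integral\<^sup>L lborel f) \<le> C * (unit_ball_vol DIM('x) * \<rho> ^ DIM('x))"
    using 2 integral_norm_bound[of lborel f] by linarith
qed

lemma compact_support_bounded:
  fixes f :: "'x::euclidean_space \<Rightarrow> 'b::real_normed_vector"
  assumes "continuous_on UNIV f" and supp: "\<And>y. f y \<noteq> 0 \<Longrightarrow> norm y < r"
  obtains B where "B \<ge> 0" "\<And>y. norm (f y) \<le> B"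
proof -
  have "compact (f ` cball 0 r)"
    by (intro compact_continuous_image continuous_on_subset[OF assms(1)]) auto
  then obtain B where B: "\<And>y. norm y \<le> r \<Longrightarrow> norm (f y) \<le> B"
    by (force dest!: compact_imp_bounded simp: bounded_iff)
  have "norm (f y) \<le> max B 0" for y
    using B[of y] supp[of y] by (cases "f y = 0") auto
  then show thesis using that[of "max B 0"] by auto
qed

lemma lborel_integral_affine:
  fixes f :: "'x::euclidean_space \<Rightarrow> 'b::{banach, second_countable_topology}"
  assumes c: "c \<noteq> 0" and f[measurable]: "f \<in> borel_measurable borel"
  shows "integral\<^sup>L lborel f = \<bar>c\<bar> ^ DIM('x) *\<^sub>R (\<integral>y. f (T + c *\<^sub>R y) \<partial>lborel)"
proof -
  have "integral\<^sup>L lborel f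
      = integral\<^sup>L (density (distr lborel borel (\<lambda>x. T + c *\<^sub>R x)) (\<lambda>_. ennreal (\<bar>c\<bar> ^ DIM('x)))) f"
    by (subst lborel_affine[OF c, of T]) (simp add: ennreal_power)
  also have "\<dots> = (\<integral>y. \<bar>c\<bar> ^ DIM('x) *\<^sub>R f (T + c *\<^sub>R y) \<partial>lborel)"
    by (subst integral_density) (auto simp: integral_distr)
  finally show ?thesis by simp
qed

text \<open>By translation invariance the integral of \<open>h (y + s)\<close> over \<open>y\<close>
  does not depend on \<open>s\<close>. Differentiating under the integral at \<open>s = 0\<close>
  exhibits the integral of \<open>H\<close> as the gradient of a constant.\<close>

lemma integral_gradient_eq_0:
  fixes h :: "'x::euclidean_space \<Rightarrow> real" and H :: "'x \<Rightarrow> 'x"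
  assumes der: "\<And>y. (h has_derivative (\<lambda>k. k \<bullet> H y)) (at y)"
    and Hc: "continuous_on UNIV H"
    and hs: "\<And>y. h y \<noteq> 0 \<Longrightarrow> norm y < r" and Hs: "\<And>y. H y \<noteq> 0 \<Longrightarrow> norm y < r"
  shows "integral\<^sup>L lborel H = 0"
proof -
  have hc: "continuous_on UNIV h"
    by (simp add: continuous_at_imp_continuous_on has_derivative_continuous[OF der])
  have [measurable]: "h \<in> borel_measurable borel" "H \<in> borel_measurable borel"
    using hc Hc by (auto intro: borel_measurable_continuous_onI)
  obtain B where B: "B \<ge> 0" "\<And>y. norm (h y) \<le> B" using compact_support_bounded[OF hc hs] by blast
  obtain C where C: "C \<ge> 0" "\<And>y. norm (H y) \<le> C" using compact_support_bounded[OF Hc Hs] by blast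
  have "((\<lambda>s. \<integral>y. h (y + s) \<partial>lborel) has_derivative (\<lambda>k. k \<bullet> (\<integral>y. H (y + 0) \<partial>lborel))) (at 0)"
  proof (rule has_gradient_integral[where e = 1 and g = "\<lambda>y. C * indicator (ball 0 (r + 1)) y"])
    fix s :: 'x assume s: "s \<in> ball 0 1"
    have *: "norm y < r + 1" if "norm (y + s) < r" for y
      using that s norm_triangle_ineq4[of "y + s" s] by simp
    show "integrable lborel (\<lambda>y. h (y + s))"
    proof (cases "r + 1 \<ge> 0")
      case True
      show ?thesis
        by (rule integral_support_bound(1)[where x = 0 and \<rho> = "r + 1" and C = B])
          (use B hs * True in \<open>auto simp: dist_norm\<close>)
    next
      case False
      then have "h (y + s) = 0" for y using hs[of "y + s"] by (smt (verit) norm_ge_zero)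
      then show ?thesis by simp
    qed
    fix y :: 'x
    show "((\<lambda>s. h (y + s)) has_derivative (\<lambda>k. k \<bullet> H (y + s))) (at s)"
      by (rule has_derivative_compose[of "\<lambda>s. y + s" "\<lambda>k. k" _ _ h, OF _ der])
        (auto intro!: derivative_eq_intros)
    show "norm (H (y + s)) \<le> C * indicator (ball 0 (r + 1)) y"
      using C(2)[of "y + s"] Hs[of "y + s"] *[of y] by (cases "H (y + s) = 0") (auto simp: C(1))
  next
    show "integrable lborel (\<lambda>y. C * indicator (ball 0 (r + 1)) (y::'x))"
      by (intro integrable_mult_right integrable_real_indicator emeasure_bounded_finite) auto
  qed auto
  moreover have "(\<integral>y. h (y + s) \<partial>lborel) = integral\<^sup>L lborel h" for s
    using lborel_integral_affine[of 1 h s] by (simp add: add.commute)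
  ultimately have "((\<lambda>s::'x. integral\<^sup>L lborel h) has_derivative (\<lambda>k. k \<bullet> integral\<^sup>L lborel H)) (at 0)"
    by simp
  then have "(\<lambda>k. k \<bullet> integral\<^sup>L lborel H) = (\<lambda>k. 0)"
    using has_derivative_const has_derivative_unique by blast
  then have "integral\<^sup>L lborel H \<bullet> integral\<^sup>L lborel H = 0" by meson
  then show ?thesis by simp
qed

lemma integrable_inverse_square:
  "integrable lborel (\<lambda>t::real. indicator {0..} t * (C / (1 + t)\<^sup>2))"
proof -
  have "integrable lborel (\<lambda>t::real. indicator {0..} t * (1 / (1 + t)\<^sup>2))"
  proof (rule integrableI_nonneg)
    have "(\<integral>\<^sup>+t. ennreal (1 / (1 + t)\<^sup>2) * indicator {0..} t \<partial>lborel) = ennreal (0 - (- 1 / (1 + 0)))"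
    proof (rule nn_integral_FTC_atLeast[where F = "\<lambda>t::real. - 1 / (1 + t)"])
      fix t :: real assume t: "0 \<le> t"
      show "((\<lambda>t. - 1 / (1 + t)) has_field_derivative 1 / (1 + t)\<^sup>2) (at t)"
        using t by (auto intro!: derivative_eq_intros simp: power2_eq_square)
    next
      show "((\<lambda>t::real. - 1 / (1 + t)) \<longlongrightarrow> 0) at_top"
        by (intro tendsto_divide_0[OF tendsto_const] filterlim_at_top_imp_at_infinity
            filterlim_tendsto_add_at_top[OF tendsto_const] filterlim_ident)
    qed auto
    then have "(\<integral>\<^sup>+t. ennreal (1 / (1 + t)\<^sup>2) * indicator {0..} t \<partial>lborel) < \<infinity>" by simp
    then show "(\<integral>\<^sup>+t. ennreal (indicator {0..} t * (1 / (1 + t)\<^sup>2)) \<partial>lborel) < \<infinity>"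
      by (subst nn_integral_cong[where v = "\<lambda>t. ennreal (1 / (1 + t)\<^sup>2) * indicator {0..} t"])
        (auto split: split_indicator)
  qed auto
  from integrable_mult_right[OF this, of C] show ?thesis
    by (rule back_subst[where P = "integrable lborel"]) (auto split: split_indicator)
qed

section \<open>The field and its gradient as integrals over t\<close>

lemma borel_measurable_vec_nth [measurable (raw)]:
  fixes f :: "'a \<Rightarrow> real^'n"
  assumes "f \<in> borel_measurable M"
  shows "(\<lambda>x. f x $ j) \<in> borel_measurable M"
  unfolding cart_eq_inner_axis using assms by measurable

text \<open>\<open>P\<close> is the gradient of \<open>\<psi>\<close>, and \<open>F\<close> stands
  for the extension by 0, which may jump across the boundary of the domain; hence it is only asked
  to be measurable. One radius \<open>r\<close> and one bound \<open>B\<close> serve all three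
  functions.\<close>

locale bogovskii =
  fixes \<psi> :: "real^'n \<Rightarrow> real" and P :: "real^'n \<Rightarrow> real^'n" and F :: "real^'n \<Rightarrow> real"
    and r B :: real
  assumes psi_deriv: "\<And>x. (\<psi> has_derivative (\<lambda>h. h \<bullet> P x)) (at x)"
    and P_cont: "continuous_on UNIV P"
    and psi_supp: "\<And>x. \<psi> x \<noteq> 0 \<Longrightarrow> norm x < r"
    and P_supp: "\<And>x. P x \<noteq> 0 \<Longrightarrow> norm x < r"
    and F_supp: "\<And>x. F x \<noteq> 0 \<Longrightarrow> norm x < r"
    and psi_bd: "\<And>x. \<bar>\<psi> x\<bar> \<le> B" and P_bd: "\<And>x. norm (P x) \<le> B" and F_bd: "\<And>x. \<bar>F x\<bar> \<le> B"
    and F_meas [measurable]: "F \<in> borel_measurable borel"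
    and r_pos: "r > 0"
begin

lemma B_nonneg: "B \<ge> 0" using psi_bd[of 0] by linarith

lemma psi_cont: "continuous_on UNIV \<psi>"
  by (simp add: continuous_at_imp_continuous_on has_derivative_continuous[OF psi_deriv])

lemma psi_meas [measurable]: "\<psi> \<in> borel_measurable borel"
  using psi_cont by (rule borel_measurable_continuous_onI)

lemma P_meas [measurable]: "P \<in> borel_measurable borel"
  using P_cont by (rule borel_measurable_continuous_onI)

lemma comp_has_derivative [derivative_intros]:
  assumes "(g has_derivative g') (at x within S)"
  shows "((\<lambda>z. \<psi> (g z)) has_derivative (\<lambda>h. g' h \<bullet> P (g x))) (at x within S)"
  using has_derivative_compose[OF assms psi_deriv] .

lemma comp_continuous [continuous_intros]:
  assumes "continuous_on S g"
  shows "continuous_on S (\<lambda>z. \<psi> (g z))" "continuous_on S (\<lambda>z. P (g z))"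
  using continuous_on_compose2[OF psi_cont assms] continuous_on_compose2[OF P_cont assms] by auto

abbreviation ray :: "real \<Rightarrow> real^'n \<Rightarrow> real^'n \<Rightarrow> real^'n" where
  "ray t x y \<equiv> x + t *\<^sub>R (x - y)"

text \<open>The vector field of the theorem is the integral of \<open>U t\<close> over \<open>t \<ge> 0\<close> (with
  \<open>\<xi> = |x - y| (1 + t)\<close>), and \<open>G t\<close> is the gradient of \<open>U t\<close> in \<open>x\<close>. Up to sign, \<open>dG t j x\<close> is the
  gradient in \<open>y\<close> of \<open>(x - y) $ j * \<psi> (ray t x y)\<close>; it is the most singular part of \<open>kG\<close>.\<close>

definition kU where "kU t j x y = (1 + t) ^ (CARD('n) - 1) * (F y * ((x - y) $ j * \<psi> (ray t x y)))"
definition U where "U t j x = (\<integral>y. kU t j x y \<partial>lborel)"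
definition dG where "dG t j x y = \<psi> (ray t x y) *\<^sub>R axis j 1 + ((x - y) $ j * t) *\<^sub>R P (ray t x y)"
definition kG where "kG t j x y = ((1 + t) ^ (CARD('n) - 1) * F y) *\<^sub>R (dG t j x y + (x - y) $ j *\<^sub>R P (ray t x y))"
definition G where "G t j x = (\<integral>y. kG t j x y \<partial>lborel)"
definition A where "A t x = (1 + t) ^ CARD('n) * (\<integral>y. F y * \<psi> (ray t x y) \<partial>lborel)"

lemma ray_bound:
  assumes "t \<ge> 0" "norm x \<le> a" "norm (ray t x y) < r"
  shows "t * norm (x - y) < r + a"
proof -
  have "t * norm (x - y) = norm (ray t x y - x)" using assms(1) by simp
  also have "\<dots> \<le> norm (ray t x y) + norm x" by (rule norm_triangle_ineq4)
  finally show ?thesis using assms by linarith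
qed

text \<open>The support of \<open>\<psi>\<close> controls \<open>t * norm (x - y)\<close> and the
  support of \<open>F\<close> controls \<open>norm (x - y)\<close>. Adding the two puts
  \<open>1 + t\<close> in the denominator, so the estimate does not degenerate at
  \<open>t = 0\<close>.\<close>

lemma ray_dist_bound:
  assumes "t \<ge> 0" "norm x \<le> a" "norm (ray t x y) < r" "norm y < r"
  shows "dist x y < 2 * (r + a) / (1 + t)"
proof -
  have "norm (x - y) < r + a" using norm_triangle_ineq4[of x y] assms by linarith
  with ray_bound[OF assms(1-3)] have "(1 + t) * norm (x - y) < 2 * (r + a)"
    by (simp add: algebra_simps)
  then show ?thesis using assms(1) by (simp add: dist_norm field_simps)
qed

lemma measurable_kU_pair [measurable]:
  "(\<lambda>(t, y). kU t j x y) \<in> borel_measurable (borel \<Otimes>\<^sub>M borel)"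
  unfolding kU_def by measurable

lemma measurable_kG_pair [measurable]:
  "(\<lambda>(t, y). kG t j x y) \<in> borel_measurable (borel \<Otimes>\<^sub>M borel)"
  unfolding kG_def dG_def by measurable

lemma measurable_kU [measurable]: "kU t j x \<in> borel_measurable borel"
  unfolding kU_def by measurable

lemma measurable_kG [measurable]: "kG t j x \<in> borel_measurable borel"
  unfolding kG_def dG_def by measurable

lemma measurable_dG [measurable]: "dG t j x \<in> borel_measurable borel"
  unfolding dG_def by measurable

lemma measurable_U [measurable]: "(\<lambda>t. U t j x) \<in> borel_measurable borel"
  unfolding U_def by measurable

lemma measurable_G [measurable]: "(\<lambda>t. G t j x) \<in> borel_measurable borel"
  unfolding G_def by measurable

text \<open>The count of powers behind the rate of \<open>U\<close>: the weight has exponent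
  \<open>n - 1\<close>, the factor \<open>x - y\<close> contributes -1 and the volume of the support
  contributes \<open>-n\<close>, which leaves -2.\<close>

lemma weight_power:
  fixes t L :: real assumes "t \<ge> 0"
  shows "((1 + t) ^ (CARD('n) - 1) * C * (L / (1 + t))) * (c * (L / (1 + t)) ^ CARD('n)) = C * L * c * L ^ CARD('n) / (1 + t)\<^sup>2"
proof -
  obtain m where m: "CARD('n) = Suc m" using not0_implies_Suc[of "CARD('n)"] by auto
  have "q ^ m * C * (L / q) * (c * (L / q) ^ Suc m) = C * L * c * L ^ Suc m / q\<^sup>2" if "q \<noteq> 0" for q
    using that by (simp add: power_divide power2_eq_square)
  then show ?thesis unfolding m using assms by simp
qed

text \<open>With \<open>L = 2 * (r + a)\<close>: the bounds of the two bounded factors, one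
  \<open>L\<close> for the factor \<open>x - y\<close>, and the volume of a ball of radius
  \<open>L\<close>; all powers of \<open>1 + t\<close> are split off.\<close>

definition decay_const where "decay_const a = B * B * (2 * (r + a)) * unit_ball_vol (CARD('n)) * (2 * (r + a)) ^ CARD('n)"

text \<open>Common estimate for the kernel of \<open>U\<close> and for the mild part of the kernel
  of \<open>G\<close>: both carry an explicit factor of size \<open>dist x y\<close> and live where
  the ray and \<open>y\<close> lie in the ball of radius \<open>r\<close>.\<close>

lemma kernel_bounds:
  fixes f :: "real^'n \<Rightarrow> 'b::{banach, second_countable_topology}"
  assumes t: "t \<ge> 0" and x: "norm x \<le> a" and [measurable]: "f \<in> borel_measurable borel"
    and f: "\<And>y. norm (f y) \<le> (1 + t) ^ (CARD('n) - 1) * (B * B) * dist x y"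
    and supp: "\<And>y. f y \<noteq> 0 \<Longrightarrow> norm (ray t x y) < r \<and> norm y < r"
  shows "integrable lborel f" "(\<integral>y. norm (f y) \<partial>lborel) \<le> decay_const a / (1 + t)\<^sup>2"
    "norm (integral\<^sup>L lborel f) \<le> decay_const a / (1 + t)\<^sup>2"
proof -
  let ?L = "2 * (r + a)"
  have a: "a \<ge> 0" using x norm_ge_zero order_trans by blast
  have s: "dist x y < ?L / (1 + t)" if "f y \<noteq> 0" for y
    using ray_dist_bound[OF t x] supp[OF that] by blast
  have L: "?L / (1 + t) \<ge> 0" using a r_pos t by simp
  have b: "norm (f y) \<le> (1 + t) ^ (CARD('n) - 1) * (B * B) * (?L / (1 + t))" for y
  proof (cases "f y = 0")
    case True
    have "0 \<le> (1 + t) ^ (CARD('n) - 1) * (B * B) * (?L / (1 + t))"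
      using L t B_nonneg by (intro mult_nonneg_nonneg) auto
    with True show ?thesis by simp
  next
    case False
    show ?thesis
      by (rule order_trans[OF f mult_left_mono]) (use s[OF False] t in auto)
  qed
  show "integrable lborel f" "(\<integral>y. norm (f y) \<partial>lborel) \<le> decay_const a / (1 + t)\<^sup>2"
    "norm (integral\<^sup>L lborel f) \<le> decay_const a / (1 + t)\<^sup>2"
    using integral_support_bound[OF assms(3) b s L]
    unfolding DIM_cart DIM_real mult_1_right weight_power[OF t] decay_const_def by simp_all
qed

lemma prod_le: "\<bar>p\<bar> \<le> B \<Longrightarrow> \<bar>q\<bar> \<le> B \<Longrightarrow> \<bar>s\<bar> \<le> d \<Longrightarrow> \<bar>p * (s * q)\<bar> \<le> B * B * d" for p q s d :: real
  using mult_mono[OF mult_mono[of "\<bar>p\<bar>" B "\<bar>q\<bar>" B], of "\<bar>s\<bar>" d] B_nonneg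
  by (simp add: abs_mult mult.commute mult.left_commute)

lemma comp_le_dist: "\<bar>(x - y) $ j\<bar> \<le> dist x y" for x y :: "real^'n"
  unfolding dist_norm by (rule component_le_norm_cart)

lemma kU_bounds:
  assumes t: "t \<ge> 0" and x: "norm x \<le> a"
  shows "integrable lborel (kU t j x)" "(\<integral>y. norm (kU t j x y) \<partial>lborel) \<le> decay_const a / (1 + t)\<^sup>2"
    "\<bar>U t j x\<bar> \<le> decay_const a / (1 + t)\<^sup>2"
proof -
  have b: "norm (kU t j x y) \<le> (1 + t) ^ (CARD('n) - 1) * (B * B) * dist x y" for y
  proof -
    have "norm (kU t j x y) = (1 + t) ^ (CARD('n) - 1) * \<bar>F y * ((x - y) $ j * \<psi> (ray t x y))\<bar>"
      using t unfolding kU_def real_norm_def abs_mult[of "(1 + t) ^ (CARD('n) - 1)"] by simp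
    also have "\<dots> \<le> (1 + t) ^ (CARD('n) - 1) * (B * B * dist x y)"
      using t by (intro mult_left_mono prod_le F_bd psi_bd comp_le_dist) simp
    finally show ?thesis by (simp only: mult.assoc)
  qed
  have s: "norm (ray t x y) < r \<and> norm y < r" if "kU t j x y \<noteq> 0" for y
    using that psi_supp F_supp by (auto simp: kU_def)
  show "integrable lborel (kU t j x)" "(\<integral>y. norm (kU t j x y) \<partial>lborel) \<le> decay_const a / (1 + t)\<^sup>2"
    "\<bar>U t j x\<bar> \<le> decay_const a / (1 + t)\<^sup>2"
    using kernel_bounds[OF t x measurable_kU b] s unfolding U_def real_norm_def by blast+
qed

text \<open>The explicit factor \<open>t\<close> is absorbed because
  \<open>t * norm (x - y) < r + a\<close> on the support of \<open>P\<close>. The result is bounded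
  uniformly in \<open>t\<close> but does not decay, which is why the cancellation is needed
  later.\<close>

lemma dG_bound:
  assumes t: "t \<ge> 0" and x: "norm x \<le> a"
  shows "norm (dG t j x y) \<le> B + (r + a) * B"
proof -
  have "norm (dG t j x y) \<le> norm (\<psi> (ray t x y) *\<^sub>R axis j (1::real)) + norm (((x - y) $ j * t) *\<^sub>R P (ray t x y))"
    unfolding dG_def by (rule norm_triangle_ineq)
  moreover have "norm (((x - y) $ j * t) *\<^sub>R P (ray t x y)) \<le> (r + a) * B"
  proof (cases "P (ray t x y) = 0")
    case True
    moreover have "0 \<le> (r + a) * B" using x norm_ge_zero[of x] r_pos B_nonneg by (intro mult_nonneg_nonneg) linarith+
    ultimately show ?thesis by simp
  next
    case False
    have "\<bar>(x - y) $ j * t\<bar> \<le> t * norm (x - y)"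
      using mult_left_mono[OF comp_le_dist[of x y j] t] t
      unfolding abs_mult dist_norm mult.commute[of _ t] by simp
    also have "\<dots> \<le> r + a" using ray_bound[OF t x P_supp[OF False]] by simp
    finally have "\<bar>(x - y) $ j * t\<bar> \<le> r + a" .
    then show ?thesis unfolding norm_scaleR by (rule mult_mono) (use P_bd x r_pos order_trans[OF norm_ge_zero x] in \<open>auto\<close>)
  qed
  ultimately show ?thesis using psi_bd[of "ray t x y"] by simp
qed

lemma dG_supp: "dG t j x y \<noteq> 0 \<Longrightarrow> norm (ray t x y) < r"
  using psi_supp[of "ray t x y"] P_supp[of "ray t x y"]
  by (cases "\<psi> (ray t x y) = 0"; cases "P (ray t x y) = 0") (auto simp: dG_def)

text \<open>A majorant for fixed \<open>t\<close>, uniform over bounded sets of \<open>x\<close>,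
  since \<open>F\<close> alone confines \<open>y\<close> to a ball. It grows with \<open>t\<close>,
  so it serves only for differentiating and passing to limits under the
  \<open>y\<close>-integral.\<close>

lemma kG_bound:
  assumes t: "t \<ge> 0" and x: "norm x \<le> a"
  shows "norm (kG t j x y) \<le> (1 + t) ^ (CARD('n) - 1) * (B * (B + 2 * (r + a) * B)) * indicator (ball 0 r) y"
proof (cases "F y = 0")
  case True
  have "a \<ge> 0" using x norm_ge_zero order_trans by blast
  then show ?thesis using True t r_pos B_nonneg by (simp add: kG_def)
next
  case False
  have a: "a \<ge> 0" using x norm_ge_zero order_trans by blast
  have "norm (x - y) \<le> a + r" using F_supp[OF False] norm_triangle_ineq4[of x y] x by linarith
  then have "norm ((x - y) $ j *\<^sub>R P (ray t x y)) \<le> (r + a) * B"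
    using component_le_norm_cart[of "x - y" j] P_bd[of "ray t x y"] unfolding norm_scaleR
    by (intro mult_mono) auto
  then have "norm (dG t j x y + (x - y) $ j *\<^sub>R P (ray t x y)) \<le> B + 2 * (r + a) * B"
    using dG_bound[OF t x, of j y] norm_triangle_ineq[of "dG t j x y" "(x - y) $ j *\<^sub>R P (ray t x y)"]
    by (simp add: algebra_simps)
  then have "\<bar>F y\<bar> * norm (dG t j x y + (x - y) $ j *\<^sub>R P (ray t x y)) \<le> B * (B + 2 * (r + a) * B)"
    by (intro mult_mono F_bd) (use B_nonneg in auto)
  then have "(1 + t) ^ (CARD('n) - 1) * (\<bar>F y\<bar> * norm (dG t j x y + (x - y) $ j *\<^sub>R P (ray t x y)))
      \<le> (1 + t) ^ (CARD('n) - 1) * (B * (B + 2 * (r + a) * B))"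
    using t by (intro mult_left_mono) auto
  moreover have "norm (kG t j x y) = (1 + t) ^ (CARD('n) - 1) * (\<bar>F y\<bar> * norm (dG t j x y + (x - y) $ j *\<^sub>R P (ray t x y)))"
    using t unfolding kG_def norm_scaleR abs_mult by simp
  moreover have "indicator (ball 0 r) y = (1::real)" using F_supp[OF False] by simp
  ultimately show ?thesis by simp
qed

text \<open>Moving \<open>x\<close> by \<open>h\<close> moves the ray by
  \<open>(1 + t) *\<^sub>R h\<close>. The part with \<open>t\<close> goes into \<open>dG\<close>;
  the remaining \<open>h\<close> gives the second, milder summand of \<open>kG\<close>.\<close>

lemma kU_derivative:
  "((\<lambda>x. kU t j x y) has_derivative (\<lambda>h. h \<bullet> kG t j x y)) (at x)"
proof -
  have "((\<lambda>x. kU t j x y) has_derivative (\<lambda>h. (1 + t) ^ (CARD('n) - 1) * (F y * ((x - y) $ j * ((h + t *\<^sub>R h) \<bullet> P (ray t x y)) + h $ j * \<psi> (ray t x y))))) (at x)"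
    unfolding kU_def
    by (auto intro!: derivative_eq_intros bounded_linear.has_derivative[OF bounded_linear_vec_nth])
  moreover have "(1 + t) ^ (CARD('n) - 1) * (F y * ((x - y) $ j * ((h + t *\<^sub>R h) \<bullet> P (ray t x y)) + h $ j * \<psi> (ray t x y))) = h \<bullet> kG t j x y" for h
    by (simp add: kG_def dG_def inner_add_right inner_add_left inner_axis algebra_simps)
  ultimately show ?thesis by simp
qed

lemma integrable_const_ball: "integrable lborel (\<lambda>y::real^'n. C * indicator (ball 0 r) y :: real)"
  by (intro integrable_mult_right integrable_real_indicator emeasure_bounded_finite) auto

lemma norm_le_of_ball1: "z \<in> ball x 1 \<Longrightarrow> norm z \<le> norm x + 1" for x z :: "real^'n"
  using norm_triangle_ineq2[of z x] by (simp add: dist_norm norm_minus_commute)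

lemma U_derivative:
  assumes t: "t \<ge> 0"
  shows "(U t j has_derivative (\<lambda>h. h \<bullet> G t j x)) (at x)"
proof -
  have "((\<lambda>x. \<integral>y. kU t j x y \<partial>lborel) has_derivative (\<lambda>h. h \<bullet> (\<integral>y. kG t j x y \<partial>lborel))) (at x)"
    by (rule has_gradient_integral[where e = 1, OF _ _ kU_derivative _ integrable_const_ball kG_bound[OF t norm_le_of_ball1]])
      (auto intro: kU_bounds(1)[OF t order_refl])
  then show ?thesis unfolding U_def[abs_def] G_def .
qed

lemma integrable_kG: 
  assumes t: "t \<ge> 0" 
  shows "integrable lborel (kG t j x)"
proof (rule Bochner_Integration.integrable_bound[OF integrable_const_ball])
  show "AE y in lborel. norm (kG t j x y)
      \<le> norm ((1 + t) ^ (CARD('n) - 1) * (B * (B + 2 * (r + norm x) * B)) * indicator (ball 0 r) y)"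
    using kG_bound[OF t order_refl, of j x] unfolding real_norm_def
    by (intro AE_I2 order_trans[OF _ abs_ge_self])
qed simp

lemma G_continuous:
  assumes t: "t \<ge> 0"
  shows "continuous_on UNIV (G t j)"
  unfolding G_def[abs_def]
proof (rule continuous_on_integral_dominated)
  show "continuous_on UNIV (\<lambda>x. kG t j x y)" for y
    unfolding kG_def dG_def by (intro continuous_intros)
  fix x :: "real^'n"
  show "\<exists>T g. open T \<and> x \<in> T \<and> integrable lborel g \<and> (\<forall>z\<in>T \<inter> UNIV. \<forall>a\<in>space lborel. norm (kG t j z a) \<le> g a)"
    using kG_bound[OF t norm_le_of_ball1]
    by (intro exI[of _ "ball x 1"] exI[of _ "\<lambda>y. (1 + t) ^ (CARD('n) - 1) * (B * (B + 2 * (r + (norm x + 1)) * B)) * indicator (ball 0 r) y"]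
        conjI integrable_const_ball ballI) simp_all
qed auto

end

section \<open>Convergence of the \<open>t\<close>-integral and decay estimates for the
  gradients\<close>

context bogovskii begin

definition v where "v j x = (\<integral>t. indicator {0..} t * U t j x \<partial>lborel)"

lemma U_dom:
  assumes "norm x \<le> a"
  shows "norm (indicator {0..} t * U t j x) \<le> indicator {0..} t * (decay_const a / (1 + t)\<^sup>2)"
  using kU_bounds(3)[OF _ assms, of t j] by (auto split: split_indicator)

lemma integrable_U: "integrable lborel (\<lambda>t. indicator {0..} t * U t j x)"
proof (rule Bochner_Integration.integrable_bound[OF integrable_inverse_square])
  show "AE t in lborel. norm (indicator {0..} t * U t j x) \<le> norm (indicator {0..} t * (decay_const (norm x) / (1 + t)\<^sup>2))"
    using U_dom[OF order_refl, of _ j x] unfolding real_norm_def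
    by (intro AE_I2 order_trans[OF _ abs_ge_self])
qed simp

lemma v_continuous: "continuous_on UNIV (v j)"
  unfolding v_def[abs_def]
proof (rule continuous_on_integral_dominated)
  show "continuous_on UNIV (\<lambda>x. indicator {0..} t * U t j x)" for t :: real
  proof (cases "t \<ge> 0")
    case True
    then show ?thesis
      by (intro continuous_intros continuous_at_imp_continuous_on ballI has_derivative_continuous[OF U_derivative])
  qed simp
  fix x :: "real^'n"
  show "\<exists>T g. open T \<and> x \<in> T \<and> integrable lborel g \<and> (\<forall>z\<in>T \<inter> UNIV. \<forall>t\<in>space lborel. norm (indicator {0..} t * U t j z) \<le> g t)"
    using U_dom[OF norm_le_of_ball1]
    by (intro exI[of _ "ball x 1"] exI[of _ "\<lambda>t. indicator {0..} t * (decay_const (norm x + 1) / (1 + t)\<^sup>2)"]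
        conjI integrable_inverse_square ballI) simp_all
qed auto

text \<open>For \<open>t > 0\<close> the condition on the ray confines \<open>y\<close> to a bounded
  set, so \<open>- dG t j x\<close> is the \<open>y\<close>-gradient of a compactly supported
  function. At \<open>t = 0\<close> the ray is \<open>x\<close> for every \<open>y\<close> and this
  compactness is lost.\<close>

lemma integral_dG:
  assumes t: "t > 0"
  shows "integrable lborel (dG t j x)" "integral\<^sup>L lborel (dG t j x) = 0"
proof -
  define a where "a = norm x"
  have supp: "norm y < (r + a) / t + a" if "norm (ray t x y) < r" for y
  proof -
    have "t * norm (x - y) < r + a" using ray_bound[of t x a y] t that by (simp add: a_def)
    then have "norm (x - y) < (r + a) / t" using t by (simp add: field_simps)
    then show ?thesis using norm_triangle_ineq3[of x y] by (simp add: a_def)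
  qed
  have a: "(r + a) / t + a \<ge> 0" using t r_pos by (simp add: a_def)
  show "integrable lborel (dG t j x)"
    by (rule integral_support_bound(1)[OF measurable_dG dG_bound[of t x a] _ a, where x = 0])
      (use t supp[OF dG_supp] in \<open>auto simp: a_def\<close>)
  have "integral\<^sup>L lborel (\<lambda>y. - dG t j x y) = 0"
  proof (rule integral_gradient_eq_0[where h = "\<lambda>y. (x - y) $ j * \<psi> (ray t x y)"])
    show "((\<lambda>y. (x - y) $ j * \<psi> (ray t x y)) has_derivative (\<lambda>k. k \<bullet> - dG t j x y)) (at y)" for y
    proof -
      have "((\<lambda>y. (x - y) $ j * \<psi> (ray t x y)) has_derivative
          (\<lambda>k. (x - y) $ j * ((- (t *\<^sub>R k)) \<bullet> P (ray t x y)) + (- k $ j) * \<psi> (ray t x y))) (at y)"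
        by (auto intro!: derivative_eq_intros bounded_linear.has_derivative[OF bounded_linear_vec_nth])
      moreover have "(x - y) $ j * ((- (t *\<^sub>R k)) \<bullet> P (ray t x y)) + (- k $ j) * \<psi> (ray t x y) = k \<bullet> - dG t j x y" for k
        by (simp add: dG_def inner_add_right inner_axis algebra_simps)
      ultimately show ?thesis by simp
    qed
    show "continuous_on UNIV (\<lambda>y. - dG t j x y)"
      unfolding dG_def by (intro continuous_intros)
    show "norm y < (r + a) / t + a" if "(x - y) $ j * \<psi> (ray t x y) \<noteq> 0" for y
      using that psi_supp supp by auto
    show "norm y < (r + a) / t + a" if "- dG t j x y \<noteq> 0" for y
      using that dG_supp supp by auto
  qed
  then show "integral\<^sup>L lborel (dG t j x) = 0" by simp
qed

text \<open>Since \<open>dG t j x\<close> has mean zero, \<open>F x\<close> may be subtracted from \<open>F y\<close>.\<close>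

lemma G_split:
  assumes t: "t > 0"
  shows "G t j x = (1 + t) ^ (CARD('n) - 1) *\<^sub>R (\<integral>y. (F y - F x) *\<^sub>R dG t j x y \<partial>lborel)
    + (\<integral>y. ((1 + t) ^ (CARD('n) - 1) * F y * (x - y) $ j) *\<^sub>R P (ray t x y) \<partial>lborel)" (is "_ = ?w *\<^sub>R ?I1 + ?I2")
    and "norm (\<integral>y. ((1 + t) ^ (CARD('n) - 1) * F y * (x - y) $ j) *\<^sub>R P (ray t x y) \<partial>lborel) \<le> decay_const (norm x) / (1 + t)\<^sup>2"
proof -
  let ?k = "\<lambda>y. ((1 + t) ^ (CARD('n) - 1) * F y * (x - y) $ j) *\<^sub>R P (ray t x y)"
  have b: "norm (?k y) \<le> (1 + t) ^ (CARD('n) - 1) * (B * B) * dist x y" for y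
  proof -
    have "norm (?k y) = (1 + t) ^ (CARD('n) - 1) * \<bar>F y * ((x - y) $ j * norm (P (ray t x y)))\<bar>"
      using t by (simp add: abs_mult)
    also have "\<dots> \<le> (1 + t) ^ (CARD('n) - 1) * (B * B * dist x y)"
      using t P_bd by (intro mult_left_mono prod_le F_bd comp_le_dist) auto
    finally show ?thesis by (simp only: mult.assoc)
  qed
  have s: "norm (ray t x y) < r \<and> norm y < r" if "?k y \<noteq> 0" for y
    using that P_supp F_supp by auto
  have m: "?k \<in> borel_measurable borel" by measurable
  have t0: "t \<ge> 0" using t by simp
  show "norm ?I2 \<le> decay_const (norm x) / (1 + t)\<^sup>2"
    using kernel_bounds(3)[OF t0 order_refl m b] s by blast
  have i2: "integrable lborel ?k"
    using kernel_bounds(1)[OF t0 order_refl m b] s by blast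
  have Fd: "integrable lborel (\<lambda>y. F y *\<^sub>R dG t j x y)"
  proof (rule Bochner_Integration.integrable_bound[where f = "\<lambda>y. B *\<^sub>R dG t j x y"])
    show "integrable lborel (\<lambda>y. B *\<^sub>R dG t j x y)" using integral_dG(1)[OF t] by simp
    show "AE y in lborel. norm (F y *\<^sub>R dG t j x y) \<le> norm (B *\<^sub>R dG t j x y)"
      using F_bd B_nonneg by (intro AE_I2) (auto intro: mult_right_mono)
  qed simp
  have "G t j x = (\<integral>y. ?w *\<^sub>R (F y *\<^sub>R dG t j x y) + ?k y \<partial>lborel)"
    unfolding G_def kG_def by (simp add: scaleR_add_right)
  also have "\<dots> = ?w *\<^sub>R (\<integral>y. F y *\<^sub>R dG t j x y \<partial>lborel) + ?I2"
    using Fd i2 by (subst Bochner_Integration.integral_add) (simp_all only: integrable_scaleR_right integral_scaleR_right simp_thms)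
  also have "(\<integral>y. F y *\<^sub>R dG t j x y \<partial>lborel) = ?I1"
    using Fd integral_dG[OF t] by (simp add: scaleR_diff_left)
  finally show "G t j x = ?w *\<^sub>R ?I1 + ?I2" .
qed

text \<open>Covers a bounded range of \<open>t\<close>, where points within distance
  \<open>(r + a) / t\<close> may leave the domain or exceed the scale of the Dini condition.\<close>

lemma G_crude:
  assumes t: "0 \<le> t" "t \<le> T" and x: "norm x \<le> a"
  shows "norm (G t j x) \<le> (1 + T) ^ (CARD('n) - 1) * (B * (B + 2 * (r + a) * B)) * (unit_ball_vol CARD('n) * r ^ CARD('n))"
proof -
  have a: "a \<ge> 0" using x norm_ge_zero order_trans by blast
  have "norm (integral\<^sup>L lborel (kG t j x)) \<le> (1 + T) ^ (CARD('n) - 1) * (B * (B + 2 * (r + a) * B)) * (unit_ball_vol DIM(real^'n) * r ^ DIM(real^'n))"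
  proof (rule integral_support_bound(3)[OF measurable_kG, where x = 0])
    show "dist 0 y < r" if "kG t j x y \<noteq> 0" for y using that F_supp[of y] by (auto simp: kG_def)
    show "r \<ge> 0" using r_pos by simp
    have B1: "0 \<le> B * (B + 2 * (r + a) * B)" using a r_pos B_nonneg by simp
    fix y
    have "norm (kG t j x y) \<le> (1 + t) ^ (CARD('n) - 1) * (B * (B + 2 * (r + a) * B)) * indicator (ball 0 r) y"
      by (rule kG_bound[OF t(1) x])
    also have "\<dots> \<le> (1 + t) ^ (CARD('n) - 1) * (B * (B + 2 * (r + a) * B))"
      using t B1 by (intro mult_left_le) (auto split: split_indicator)
    also have "\<dots> \<le> (1 + T) ^ (CARD('n) - 1) * (B * (B + 2 * (r + a) * B))"
      using t B1 by (intro mult_right_mono power_mono) auto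
    finally show "norm (kG t j x y) \<le> (1 + T) ^ (CARD('n) - 1) * (B * (B + 2 * (r + a) * B))" .
  qed
  then show ?thesis by (simp add: G_def)
qed

text \<open>For \<open>t \<ge> 1\<close> the weight is at most \<open>(2 * t) ^ (n - 1)\<close>, and
  the support has volume of order \<open>1 / t ^ n\<close>. This leaves the oscillation
  \<open>w\<close> at scale \<open>(r + a) / t\<close>, divided by \<open>t\<close>.\<close>

lemma dG_weighted_bound:
  fixes w :: real
  assumes t: "t \<ge> 1" and x: "norm x \<le> a"
    and osc: "\<And>y. dist x y < (r + a) / t \<Longrightarrow> \<bar>F y - F x\<bar> \<le> w"
  shows "norm ((1 + t) ^ (CARD('n) - 1) *\<^sub>R (\<integral>y. (F y - F x) *\<^sub>R dG t j x y \<partial>lborel))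
    \<le> (2 ^ (CARD('n) - 1) * (B + (r + a) * B) * unit_ball_vol CARD('n) * (r + a) ^ CARD('n)) * (w / t)"
proof -
  have a: "a \<ge> 0" using x norm_ge_zero order_trans by blast
  have near: "dist x y < (r + a) / t" if "dG t j x y \<noteq> 0" for y
    using ray_bound[OF _ x dG_supp[OF that]] t by (simp add: dist_norm field_simps)
  \<comment> \<open>The choice \<open>y = x\<close> in \<open>osc\<close>.\<close>
  have w: "w \<ge> 0" using osc[of x] a r_pos t by simp
  have K: "B + (r + a) * B \<ge> 0" using a r_pos B_nonneg by simp
  have "norm (\<integral>y. (F y - F x) *\<^sub>R dG t j x y \<partial>lborel)
      \<le> (w * (B + (r + a) * B)) * (unit_ball_vol DIM(real^'n) * ((r + a) / t) ^ DIM(real^'n))"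
  proof (rule integral_support_bound(3)[where x = x])
    show "norm ((F y - F x) *\<^sub>R dG t j x y) \<le> w * (B + (r + a) * B)" for y
    proof (cases "dG t j x y = 0")
      case True
      then show ?thesis using w K by simp
    next
      case False
      then show ?thesis unfolding norm_scaleR
        by (intro mult_mono) (use osc[OF near] dG_bound[OF _ x] t w in auto)
    qed
  qed (use near a r_pos t in auto)
  then have "(1 + t) ^ (CARD('n) - 1) * norm (\<integral>y. (F y - F x) *\<^sub>R dG t j x y \<partial>lborel)
      \<le> (2 * t) ^ (CARD('n) - 1) * ((w * (B + (r + a) * B)) * (unit_ball_vol CARD('n) * ((r + a) / t) ^ CARD('n)))"
    using t by (intro mult_mono power_mono) auto
  also have "\<dots> = (2 ^ (CARD('n) - 1) * (B + (r + a) * B) * unit_ball_vol CARD('n) * (r + a) ^ CARD('n)) * (w / t)"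
  proof -
    obtain m where m: "CARD('n) = Suc m" using not0_implies_Suc[of "CARD('n)"] by auto
    have "(2 * t) ^ m * (w * K * (c * (L / t) ^ Suc m)) = 2 ^ m * K * c * L ^ Suc m * (w / t)" for K c L
      using t by (simp add: power_divide power_mult_distrib)
    from this[of "B + (r + a) * B" "unit_ball_vol CARD('n)" "r + a"]
    show ?thesis unfolding m by simp
  qed
  finally show ?thesis using t by simp
qed

end

section \<open>Differentiability of the field in the domain, and its divergence\<close>

text \<open>\<open>\<omega>\<close> is an abstract majorant of the oscillation at scales up to
  \<open>\<delta>\<close>. The Dini condition is stated after the substitution
  \<open>\<rho> = M / t\<close>, which turns \<open>d\<rho> / \<rho>\<close> into
  \<open>dt / t\<close> up to sign; this is the shape in which the estimate for \<open>G\<close>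
  consumes it.\<close>

locale bogovskii_dini = bogovskii \<psi> P F r B
  for \<psi> :: "real^'n \<Rightarrow> real" and P :: "real^'n \<Rightarrow> real^'n" and F :: "real^'n \<Rightarrow> real" and r B :: real +
  fixes \<Omega> :: "(real^'n) set" and \<omega> :: "real \<Rightarrow> real" and \<delta> :: real
  assumes Omega_open: "open \<Omega>"
    and F_cont: "continuous_on \<Omega> F"
    and delta_pos: "\<delta> > 0"
    and osc: "\<And>x y \<rho>. x \<in> \<Omega> \<Longrightarrow> y \<in> \<Omega> \<Longrightarrow> dist x y < \<rho> \<Longrightarrow> \<rho> \<le> \<delta> \<Longrightarrow> \<bar>F x - F y\<bar> \<le> \<omega> \<rho>"
    and dini: "\<And>M. M > 0 \<Longrightarrow> integrable lborel (\<lambda>t. indicator {M / \<delta>..} t * (\<omega> (M / t) / t))"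
    and psi_int: "integral\<^sup>L lborel \<psi> = 1"
    and F_int: "integral\<^sup>L lborel F = 0"
begin

definition Gv where "Gv j x = (\<integral>t. indicator {0..} t *\<^sub>R G t j x \<partial>lborel)"

lemma decay_const_mono:
  assumes "norm z \<le> a"
  shows "decay_const (norm z) \<le> decay_const a"
proof -
  have *: "0 \<le> 2 * (r + norm z)" "2 * (r + norm z) \<le> 2 * (r + a)" "0 \<le> 2 * (r + a)"
    using order_trans[OF norm_ge_zero assms] assms r_pos by auto
  have "B * B * unit_ball_vol CARD('n) * (2 * (r + norm z)) ^ Suc CARD('n)
      \<le> B * B * unit_ball_vol CARD('n) * (2 * (r + a)) ^ Suc CARD('n)"
    using * B_nonneg by (intro mult_left_mono power_mono) auto
  then show ?thesis by (simp add: decay_const_def mult_ac)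
qed

text \<open>An integrable majorant in \<open>t\<close>, common to all points near \<open>x\<close>:
  the crude bound up to a threshold \<open>T\<close>, and beyond it the oscillation bound plus
  inverse-square decay. It yields both differentiation under the \<open>t\<close>-integral and
  continuity of the gradient.\<close>

lemma G_dominated:
  assumes x: "x \<in> \<Omega>"
  shows "\<exists>e>0. ball x e \<subseteq> \<Omega> \<and> (\<exists>g. integrable lborel g \<and> (\<forall>z\<in>ball x e. \<forall>t. norm (indicator {0..} t *\<^sub>R G t j z) \<le> g t))"
proof -
  obtain e0 where e0: "e0 > 0" "ball x e0 \<subseteq> \<Omega>" using Omega_open x openE by blast
  \<comment> \<open>Half the radius leaves room for two steps: from \<open>x\<close> to
    \<open>z\<close>, and from \<open>z\<close> to a point \<open>y\<close> within distance
    \<open>e\<close>, still inside the domain.\<close>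
  define e where "e = min 1 (e0 / 2)"
  have e: "e > 0" "e \<le> 1" "ball x (2 * e) \<subseteq> \<Omega>"
    using e0 by (auto simp: e_def intro!: order_trans[OF subset_ball e0(2)])
  define a where "a = norm x + 1"
  define M where "M = r + a"
  have a: "a \<ge> 0" by (simp add: a_def)
  have M: "M > 0" using r_pos a by (simp add: M_def)
  \<comment> \<open>For \<open>t > T\<close> the scale \<open>M / t\<close> is below
    \<open>\<delta>\<close>, where \<open>\<omega>\<close> controls the oscillation, and below
    \<open>e\<close>, so that \<open>y\<close> stays in the domain; \<open>t \<ge> 1\<close> is
    required by \<open>dG_weighted_bound\<close>.\<close>
  define T where "T = max 1 (max (M / \<delta>) (M / e))"
  have T: "T \<ge> 1" "T \<ge> M / \<delta>" "T \<ge> M / e" by (auto simp: T_def)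
  define K1 where "K1 = (1 + T) ^ (CARD('n) - 1) * (B * (B + 2 * (r + a) * B)) * (unit_ball_vol CARD('n) * r ^ CARD('n))"
  define K2 where "K2 = 2 ^ (CARD('n) - 1) * (B + (r + a) * B) * unit_ball_vol CARD('n) * (r + a) ^ CARD('n)"
  define g where "g t = indicator {0..} t * (decay_const a / (1 + t)\<^sup>2) + K1 * indicator {0..T} t + K2 * (indicator {M / \<delta>..} t * (\<omega> (M / t) / t))" for t
  have g: "integrable lborel g"
    unfolding g_def
    by (intro Bochner_Integration.integrable_add integrable_inverse_square integrable_mult_right dini[OF M]
        integrable_real_indicator emeasure_bounded_finite) auto
  have decay_const: "decay_const a \<ge> 0" unfolding decay_const_def using a r_pos B_nonneg by simp
  have K1: "K1 \<ge> 0" unfolding K1_def using a r_pos B_nonneg T by simp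
  have K2: "K2 \<ge> 0" unfolding K2_def using a r_pos B_nonneg by simp
  \<comment> \<open>The Dini term is present in \<open>g\<close> for every \<open>t\<close>, so its
    sign matters also where another term does the bounding. Comparing \<open>x\<close> with itself
    gives \<open>\<omega> (M / t) \<ge> 0\<close>.\<close>
  have w: "0 \<le> indicator {M / \<delta>..} t * (\<omega> (M / t) / t)" for t
  proof (cases "t \<ge> M / \<delta>")
    case True
    have "M / \<delta> > 0" using M delta_pos by simp
    then have "t > 0" using True by linarith
    then have "\<omega> (M / t) \<ge> 0"
      using osc[OF x x, of "M / t"] M True delta_pos by (simp add: field_simps)
    then show ?thesis using \<open>t > 0\<close> by simp
  qed simp
  have "norm (indicator {0..} t *\<^sub>R G t j z) \<le> g t" if z: "z \<in> ball x e" for z t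
  proof -
    have z': "norm z \<le> a" using z e norm_triangle_ineq2[of z x] by (simp add: a_def dist_norm norm_minus_commute)
    consider "t < 0" | "0 \<le> t" "t \<le> T" | "t > T" by linarith
    then show ?thesis
    proof cases
      case 1
      then show ?thesis using mult_nonneg_nonneg[OF K2 w[of t]] by (simp add: g_def)
    next
      case 2
      have "norm (G t j z) \<le> K1" unfolding K1_def by (rule G_crude[OF 2 z'])
      then show ?thesis using 2 decay_const mult_nonneg_nonneg[OF K2 w[of t]] by (simp add: g_def add_increasing add_increasing2)
    next
      case 3
      then have t: "t \<ge> 1" "t > 0" "t > M / \<delta>" "t > M / e" using T by auto
      then have t': "M / t \<le> \<delta>" "M / t \<le> e" using M delta_pos e by (auto simp: field_simps)
      have zO: "z \<in> \<Omega>" using z e by (auto dest!: subsetD)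
      have o: "\<bar>F y - F z\<bar> \<le> \<omega> (M / t)" if "dist z y < (r + a) / t" for y
      proof -
        have "dist x y < 2 * e" using z that t' dist_triangle[of x y z] by (simp add: M_def)
        then have "y \<in> \<Omega>" using e by auto
        with osc[OF zO this _ t'(1)] that show ?thesis by (simp add: M_def abs_minus_commute)
      qed
      have "norm (G t j z) \<le> K2 * (\<omega> (M / t) / t) + decay_const (norm z) / (1 + t)\<^sup>2"
        unfolding G_split(1)[OF t(2)] K2_def
        by (rule norm_triangle_mono[OF dG_weighted_bound[OF t(1) z' o] G_split(2)[OF t(2)]])
      moreover have "decay_const (norm z) / (1 + t)\<^sup>2 \<le> decay_const a / (1 + t)\<^sup>2"
        using decay_const_mono[OF z'] by (intro divide_right_mono) auto
      moreover have "g t = decay_const a / (1 + t)\<^sup>2 + K2 * (\<omega> (M / t) / t)"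
        unfolding g_def using t 3 by (simp add: indicator_def)
      moreover have "norm (indicator {0..} t *\<^sub>R G t j z) = norm (G t j z)" using t by simp
      ultimately show ?thesis by linarith
    qed
  qed
  moreover have "ball x e \<subseteq> \<Omega>" using e(1) by (intro order_trans[OF subset_ball e(3)]) simp
  ultimately show ?thesis using g e(1) by blast
qed

lemma v_derivative:
  assumes x: "x \<in> \<Omega>"
  shows "(v j has_derivative (\<lambda>h. h \<bullet> Gv j x)) (at x)"
proof -
  obtain e g where e: "e > 0" and g: "integrable lborel g"
    and bd: "\<And>z t. z \<in> ball x e \<Longrightarrow> norm (indicator {0..} t *\<^sub>R G t j z) \<le> g t"
    using G_dominated[OF x, of j] by blast
  have "((\<lambda>x. \<integral>t. indicator {0..} t * U t j x \<partial>lborel) has_derivative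
      (\<lambda>h. h \<bullet> (\<integral>t. indicator {0..} t *\<^sub>R G t j x \<partial>lborel))) (at x)"
  proof (rule has_gradient_integral[OF e integrable_U _ _ g bd])
    fix z t
    show "((\<lambda>z. indicator {0..} t * U t j z) has_derivative (\<lambda>h. h \<bullet> indicator {0..} t *\<^sub>R G t j z)) (at z)"
      using U_derivative[of t j z] by (cases "t \<ge> 0") auto
  qed auto
  then show ?thesis by (simp add: v_def[abs_def] Gv_def)
qed

lemma Gv_continuous: "continuous_on \<Omega> (Gv j)"
  unfolding Gv_def[abs_def]
proof (rule continuous_on_integral_dominated[OF Omega_open])
  show "continuous_on \<Omega> (\<lambda>x. indicator {0..} t *\<^sub>R G t j x)" for t :: real
  proof (cases "t \<ge> 0")
    case True
    then show ?thesis
      by (intro continuous_intros continuous_on_subset[OF G_continuous[OF True]]) simp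
  qed simp
  fix x assume x: "x \<in> \<Omega>"
  show "\<exists>T g. open T \<and> x \<in> T \<and> integrable lborel g \<and> (\<forall>z\<in>T \<inter> \<Omega>. \<forall>t\<in>space lborel. norm (indicator {0..} t *\<^sub>R G t j z) \<le> g t)"
  proof -
    obtain e g where "e > 0" "integrable lborel g"
      "\<And>z t. z \<in> ball x e \<Longrightarrow> norm (indicator {0..} t *\<^sub>R G t j z) \<le> g t"
      using G_dominated[OF x, of j] by blast
    then show ?thesis by (intro exI[of _ "ball x e"] exI[of _ g]) simp
  qed
qed simp

lemma integrable_G:
  assumes x: "x \<in> \<Omega>"
  shows "integrable lborel (\<lambda>t. indicator {0..} t *\<^sub>R G t j x)"
proof -
  obtain e g where e: "e > 0" and g: "integrable lborel g"
    and bd: "\<And>z t. z \<in> ball x e \<Longrightarrow> norm (indicator {0..} t *\<^sub>R G t j z) \<le> g t"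
    using G_dominated[OF x, of j] by blast
  show ?thesis
  proof (rule Bochner_Integration.integrable_bound[OF g])
    show "AE t in lborel. norm (indicator {0..} t *\<^sub>R G t j x) \<le> norm (g t)"
      unfolding real_norm_def using e by (intro AE_I2 order_trans[OF bd abs_ge_self]) simp
  qed simp
qed

lemma integrable_ball_bound:
  fixes f :: "real^'n \<Rightarrow> 'b::{banach, second_countable_topology}"
  assumes "f \<in> borel_measurable borel" "\<And>y. norm (f y) \<le> C * indicator (ball 0 r) y"
  shows "integrable lborel f"
proof (rule Bochner_Integration.integrable_bound[OF integrable_const_ball[of C]])
  show "AE y in lborel. norm (f y) \<le> norm (C * indicator (ball 0 r) y)"
    unfolding real_norm_def by (intro AE_I2 order_trans[OF assms(2) abs_ge_self])
qed (use assms(1) in simp)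

text \<open>The bounds hold for every real \<open>t\<close>, also negative, because differentiating
  \<open>A\<close> at \<open>t = 0\<close> uses a two-sided neighbourhood; the majorant is free of
  \<open>t\<close>.\<close>

lemma integrable_F_ray:
  shows "integrable lborel (\<lambda>y. F y * \<psi> (ray t x y))" "integrable lborel (\<lambda>y. F y * ((x - y) \<bullet> P (ray t x y)))"
    and F_ray_bound: "\<bar>F y * ((x - y) \<bullet> P (ray t x y))\<bar> \<le> B * ((norm x + r) * B) * indicator (ball 0 r) y"
proof -
  show b: "\<bar>F y * ((x - y) \<bullet> P (ray t x y))\<bar> \<le> B * ((norm x + r) * B) * indicator (ball 0 r) y" for y
  proof (cases "F y = 0")
    case True
    then show ?thesis using B_nonneg r_pos by simp
  next
    case False
    have "\<bar>(x - y) \<bullet> P (ray t x y)\<bar> \<le> norm (x - y) * norm (P (ray t x y))" by (rule Cauchy_Schwarz_ineq2)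
    also have "\<dots> \<le> (norm x + r) * B"
      using norm_triangle_ineq4[of x y] F_supp[OF False] r_pos by (intro mult_mono P_bd) auto
    finally have "\<bar>F y * ((x - y) \<bullet> P (ray t x y))\<bar> \<le> B * ((norm x + r) * B)"
      unfolding abs_mult by (rule mult_mono[OF F_bd _ B_nonneg abs_ge_zero])
    then show ?thesis using F_supp[OF False] by simp
  qed
  show "integrable lborel (\<lambda>y. F y * ((x - y) \<bullet> P (ray t x y)))"
    by (rule integrable_ball_bound[OF _ b[folded real_norm_def]]) measurable
  have b2: "norm (F y * \<psi> (ray t x y)) \<le> B * B * indicator (ball 0 r) y" for y
  proof (cases "F y = 0")
    case True
    then show ?thesis using B_nonneg by simp
  next
    case False
    have "\<bar>F y * \<psi> (ray t x y)\<bar> \<le> B * B"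
      unfolding abs_mult by (rule mult_mono[OF F_bd psi_bd B_nonneg abs_ge_zero])
    then show ?thesis using F_supp[OF False] by simp
  qed
  show "integrable lborel (\<lambda>y. F y * \<psi> (ray t x y))"
    by (rule integrable_ball_bound[OF _ b2]) measurable
qed

text \<open>Taking the trace of \<open>kG\<close>, the \<open>axis\<close> terms add up to the
  factor \<open>n\<close> and the \<open>P\<close> terms to
  \<open>(1 + t) * ((x - y) \<bullet> P)\<close>. These are the two terms of the product rule for
  \<open>A\<close>, whose integrand has \<open>t\<close>-derivative
  \<open>F y * ((x - y) \<bullet> P (ray t x y))\<close>.\<close>

lemma divergence_G:
  assumes t: "t \<ge> 0"
  shows "((\<lambda>t. A t x) has_real_derivative (\<Sum>j\<in>UNIV. G t j x $ j)) (at t)"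
proof -
  let ?I = "\<integral>y. F y * \<psi> (ray t x y) \<partial>lborel" and ?J = "\<integral>y. F y * ((x - y) \<bullet> P (ray t x y)) \<partial>lborel"
  let ?n = "CARD('n)"
  have "((\<lambda>t. \<integral>y. F y * \<psi> (ray t x y) \<partial>lborel) has_derivative (\<lambda>h. h \<bullet> ?J)) (at t)"
  proof (rule has_gradient_integral[OF zero_less_one integrable_F_ray(1) _ _ integrable_const_ball])
    show "((\<lambda>t. F y * \<psi> (ray t x y)) has_derivative (\<lambda>h. h \<bullet> (F y * ((x - y) \<bullet> P (ray s x y))))) (at s)" for s y
      by (auto intro!: derivative_eq_intros simp: mult_ac)
    show "norm (F y * ((x - y) \<bullet> P (ray s x y))) \<le> B * ((norm x + r) * B) * indicator (ball 0 r) y" for s y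
      using F_ray_bound by simp
  qed simp
  then have I: "((\<lambda>t. \<integral>y. F y * \<psi> (ray t x y) \<partial>lborel) has_real_derivative ?J) (at t)"
    by (simp add: has_field_derivative_def mult.commute[of _ ?J])
  have "((\<lambda>t. A t x) has_real_derivative (?n * (1 + t) ^ (?n - 1) * ?I + (1 + t) ^ ?n * ?J)) (at t)"
    unfolding A_def by (rule derivative_eq_intros I refl | simp)+
  moreover have "(\<Sum>j\<in>UNIV. G t j x $ j) = ?n * (1 + t) ^ (?n - 1) * ?I + (1 + t) ^ ?n * ?J"
  proof -
    have pt: "(\<Sum>j\<in>UNIV. kG t j x y $ j) = ?n * (1 + t) ^ (?n - 1) * (F y * \<psi> (ray t x y)) + (1 + t) ^ ?n * (F y * ((x - y) \<bullet> P (ray t x y)))" for y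
    proof -
      have p: "(1 + t) ^ ?n = (1 + t) ^ (?n - 1) * (1 + t)"
        by (metis power_minus_mult zero_less_card_finite)
      have k: "kG t j x y $ j = ((1 + t) ^ (?n - 1) * F y) * (\<psi> (ray t x y) + (1 + t) * ((x - y) $ j * P (ray t x y) $ j))" for j
        by (simp add: kG_def dG_def algebra_simps)
      have s: "(\<Sum>j\<in>UNIV. c * (s + d * (q $ j * p $ j))) = c * (?n * s + d * (q \<bullet> p))" for c s d :: real and q p :: "real^'n"
        by (simp add: sum_distrib_left[symmetric] sum.distrib inner_vec_def)
      have "(\<Sum>j\<in>UNIV. kG t j x y $ j) = ((1 + t) ^ (?n - 1) * F y) * (?n * \<psi> (ray t x y) + (1 + t) * ((x - y) \<bullet> P (ray t x y)))"
        unfolding k by (rule s)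
      then show ?thesis unfolding p by (simp only: ring_distribs mult_ac)
    qed
    have "G t j x $ j = (\<integral>y. kG t j x y $ j \<partial>lborel)" for j
      using integrable_kG[OF t, of j x] by (simp add: G_def cart_eq_inner_axis)
    moreover have "integrable lborel (\<lambda>y. kG t j x y $ j)" for j
      using integrable_kG[OF t, of j x] by (simp add: cart_eq_inner_axis)
    ultimately have "(\<Sum>j\<in>UNIV. G t j x $ j) = (\<integral>y. (\<Sum>j\<in>UNIV. kG t j x y $ j) \<partial>lborel)" by simp
    also have "\<dots> = ?n * (1 + t) ^ (?n - 1) * ?I + (1 + t) ^ ?n * ?J"
      unfolding pt using integrable_F_ray(1,2)[of x t] by simp
    finally show ?thesis .
  qed
  ultimately show ?thesis by simp
qed

lemma A_0: "A 0 x = 0" using F_int by (simp add: A_def)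

lemma integral_psi_ray:
  assumes t: "t > 0"
  shows "integrable lborel (\<lambda>y. \<psi> (ray t x y))" "t ^ CARD('n) * (\<integral>y. \<psi> (ray t x y) \<partial>lborel) = 1"
proof -
  have e: "(\<lambda>y. \<psi> (ray t x y)) = (\<lambda>y. \<psi> ((x + t *\<^sub>R x) + (- t) *\<^sub>R y))"
    by (simp add: algebra_simps)
  then have *: "t ^ CARD('n) * (\<integral>y. \<psi> (ray t x y) \<partial>lborel) = integral\<^sup>L lborel \<psi>"
    unfolding e using lborel_integral_affine[of "- t" \<psi> "x + t *\<^sub>R x"] t by simp
  then show "t ^ CARD('n) * (\<integral>y. \<psi> (ray t x y) \<partial>lborel) = 1" by (simp add: psi_int)
  \<comment> \<open>A non-integrable function has Bochner integral 0 by convention, so a nonzero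
    value already proves integrability.\<close>
  then have "(\<integral>y. \<psi> (ray t x y) \<partial>lborel) \<noteq> 0" by auto
  then show "integrable lborel (\<lambda>y. \<psi> (ray t x y))" using not_integrable_integral_eq by blast
qed

text \<open>The kernels \<open>t ^ n * \<psi> (ray t x y)\<close> have mass 1 and concentrate at
  \<open>y = x\<close>, so they form an approximate identity, while \<open>((1 + t) / t) ^ n\<close>
  tends to 1. The error \<open>E\<close> averages \<open>F y - F x\<close> and vanishes by
  continuity of \<open>F\<close> at \<open>x\<close>.\<close>

lemma A_limit:
  assumes x: "x \<in> \<Omega>"
  shows "((\<lambda>t. A t x) \<longlongrightarrow> F x) at_top"
proof -
  let ?n = "CARD('n)"
  define a where "a = norm x"
  \<comment> \<open>The power of 2 comes from \<open>1 + t \<le> 2 * t\<close>; the rest is the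
    bound of \<open>\<psi>\<close> times the volume of the support, with \<open>t\<close> scaled
    out.\<close>
  define K where "K = 2 ^ ?n * (B * (unit_ball_vol ?n * (r + a) ^ ?n))"
  have K: "K \<ge> 0" unfolding K_def using B_nonneg r_pos by (simp add: a_def)
  define E where "E t = A t x - F x * ((1 + t) / t) ^ ?n" for t
  have E_eq: "E t = (1 + t) ^ ?n * (\<integral>y. (F y - F x) * \<psi> (ray t x y) \<partial>lborel)" if t: "t > 0" for t
  proof -
    have "(\<integral>y. (F y - F x) * \<psi> (ray t x y) \<partial>lborel) = (\<integral>y. F y * \<psi> (ray t x y) \<partial>lborel) - F x * (\<integral>y. \<psi> (ray t x y) \<partial>lborel)"
      using integrable_F_ray(1) integral_psi_ray(1)[OF t] by (simp add: left_diff_distrib)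
    also have "(\<integral>y. \<psi> (ray t x y) \<partial>lborel) = 1 / t ^ ?n"
      using integral_psi_ray(2)[OF t, of x] t by (simp add: field_simps)
    finally show ?thesis by (simp add: E_def A_def power_divide right_diff_distrib)
  qed
  have "(E \<longlongrightarrow> 0) at_top"
  proof (rule tendstoI)
    fix \<epsilon> :: real assume eps: "\<epsilon> > 0"
    \<comment> \<open>The added 1 keeps the quotient meaningful when \<open>K = 0\<close>.\<close>
    define w where "w = \<epsilon> / (K + 1)"
    have w: "w > 0" "K * w < \<epsilon>" using eps K by (auto simp: w_def field_simps)
    obtain d where d: "d > 0" "\<And>y. dist y x < d \<Longrightarrow> \<bar>F y - F x\<bar> < w"
      using F_cont x w(1) unfolding continuous_on_eq_continuous_at[OF Omega_open] continuous_at_eps_delta dist_real_def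
      by metis
    have "dist (E t) 0 < \<epsilon>" if t: "t \<ge> max 1 ((r + a) / d)" for t
    proof -
      have t1: "t \<ge> 1" "t > 0" and td: "(r + a) / t \<le> d" using t d(1) by (auto simp: field_simps)
      have near: "dist x y < (r + a) / t" if "(F y - F x) * \<psi> (ray t x y) \<noteq> 0" for y
        using ray_bound[of t x a y] t1 psi_supp[of "ray t x y"] that by (simp add: a_def dist_norm field_simps)
      have "norm (\<integral>y. (F y - F x) * \<psi> (ray t x y) \<partial>lborel) \<le> (w * B) * (unit_ball_vol DIM(real^'n) * ((r + a) / t) ^ DIM(real^'n))"
      proof (rule integral_support_bound(3)[where x = x])
        fix y
        show "norm ((F y - F x) * \<psi> (ray t x y)) \<le> w * B"
        proof (cases "(F y - F x) * \<psi> (ray t x y) = 0")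
          case True
          show ?thesis unfolding True using w B_nonneg by simp
        next
          case False
          have "\<bar>F y - F x\<bar> < w" using d(2)[of y] near[OF False] td by (simp add: dist_commute)
          then show ?thesis unfolding norm_mult by (intro mult_mono) (use psi_bd w in auto)
        qed
      qed (use near r_pos t1 in \<open>auto simp: a_def\<close>)
      then have "(1 + t) ^ ?n * norm (\<integral>y. (F y - F x) * \<psi> (ray t x y) \<partial>lborel)
          \<le> (2 * t) ^ ?n * ((w * B) * (unit_ball_vol ?n * ((r + a) / t) ^ ?n))"
        using t1 by (intro mult_mono power_mono) auto
      also have "\<dots> = K * w" using t1 by (simp add: K_def power_divide power_mult_distrib)
      finally have "\<bar>E t\<bar> \<le> K * w" using t1 by (simp add: E_eq abs_mult)
      then show ?thesis using w by simp
    qed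
    then show "\<forall>\<^sub>F t in at_top. dist (E t) 0 < \<epsilon>" unfolding eventually_at_top_linorder by blast
  qed
  moreover have "((\<lambda>t. F x * ((1 + t) / t) ^ ?n) \<longlongrightarrow> F x) at_top"
  proof -
    have "((\<lambda>t::real. 1 + 1 / t) \<longlongrightarrow> 1 + 0) at_top"
      by (intro tendsto_intros tendsto_divide_0[OF tendsto_const] filterlim_at_top_imp_at_infinity filterlim_ident)
    then have "((\<lambda>t. F x * (1 + 1 / t) ^ ?n) \<longlongrightarrow> F x * (1 + 0) ^ ?n) at_top"
      by (intro tendsto_mult tendsto_power tendsto_const)
    moreover have "\<forall>\<^sub>F t::real in at_top. F x * (1 + 1 / t) ^ ?n = F x * ((1 + t) / t) ^ ?n"
      using eventually_gt_at_top[of 0] by eventually_elim (simp add: field_simps)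
    ultimately show ?thesis by (simp add: tendsto_cong)
  qed
  ultimately have "((\<lambda>t. E t + F x * ((1 + t) / t) ^ ?n) \<longlongrightarrow> 0 + F x) at_top" by (rule tendsto_add)
  then show ?thesis by (simp add: E_def)
qed

text \<open>The trace of \<open>G t\<close> is the \<open>t\<close>-derivative of \<open>A\<close>,
  so its integral over \<open>{0..s}\<close> is \<open>A s x\<close>. Letting \<open>s\<close> grow,
  integrability gives the full integral on one side and \<open>A_limit\<close> gives
  \<open>F x\<close> on the other.\<close>

lemma divergence_Gv:
  assumes x: "x \<in> \<Omega>"
  shows "(\<Sum>j\<in>UNIV. Gv j x $ j) = F x"
proof -
  define D where "D t = (\<Sum>j\<in>UNIV. G t j x $ j)" for t
  have c: "integrable lborel (\<lambda>t. indicator {0..} t * G t j x $ j)" "Gv j x $ j = (\<integral>t. indicator {0..} t * G t j x $ j \<partial>lborel)" for j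
  proof -
    have "integrable lborel (\<lambda>t. (indicator {0..} t *\<^sub>R G t j x) \<bullet> axis j 1)"
      using integrable_G[OF x] by (rule integrable_inner_left)
    then show "integrable lborel (\<lambda>t. indicator {0..} t * G t j x $ j)"
      by (simp add: cart_eq_inner_axis)
    have "(\<integral>t. (indicator {0..} t *\<^sub>R G t j x) \<bullet> axis j 1 \<partial>lborel) = Gv j x \<bullet> axis j 1"
      unfolding Gv_def using integrable_G[OF x] by (intro integral_inner_left)
    then show "Gv j x $ j = (\<integral>t. indicator {0..} t * G t j x $ j \<partial>lborel)"
      by (simp add: cart_eq_inner_axis)
  qed
  have Di: "integrable lborel (\<lambda>t. indicator {0..} t * D t)"
    unfolding D_def sum_distrib_left using c(1) by (intro Bochner_Integration.integrable_sum)
  have eq: "(\<Sum>j\<in>UNIV. Gv j x $ j) = (\<integral>t. indicator {0..} t * D t \<partial>lborel)"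
    unfolding D_def sum_distrib_left c(2) using c(1) by (subst Bochner_Integration.integral_sum) auto
  have "((\<lambda>s. \<integral>t. indicator {..s} t *\<^sub>R (indicator {0..} t * D t) \<partial>lborel) \<longlongrightarrow> (\<integral>t. indicator {0..} t * D t \<partial>lborel)) at_top"
    by (rule tendsto_integral_at_top[OF _ Di]) simp
  moreover have "\<forall>\<^sub>F s in at_top. (\<integral>t. indicator {..s} t *\<^sub>R (indicator {0..} t * D t) \<partial>lborel) = A s x"
    using eventually_ge_at_top[of 0]
  proof eventually_elim
    case (elim s)
    have ind: "indicator {..s} t *\<^sub>R (indicator {0..} t * D t) = indicator {0..s} t *\<^sub>R D t" for t
      by (auto split: split_indicator)
    have "integrable lborel (\<lambda>t. indicator {..s} t *\<^sub>R (indicator {0..} t * D t))"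
      using Di by (intro integrable_mult_indicator) auto
    then have si: "set_integrable lborel {0..s} D"
      unfolding set_integrable_def ind .
    have "(D has_integral A s x - A 0 x) {0..s}"
      by (rule fundamental_theorem_of_calculus[OF elim])
        (use divergence_G in \<open>auto simp: D_def has_real_derivative_iff_has_vector_derivative intro: has_vector_derivative_at_within\<close>)
    then have "integral {0..s} D = A s x" by (simp add: A_0 integral_unique)
    then show ?case
      using set_borel_integral_eq_integral(2)[OF si] unfolding ind set_lebesgue_integral_def by simp
  qed
  ultimately have "((\<lambda>s. A s x) \<longlongrightarrow> (\<integral>t. indicator {0..} t * D t \<partial>lborel)) at_top"
    by (simp add: tendsto_cong)
  then show ?thesis unfolding eq
    using A_limit[OF x] tendsto_unique trivial_limit_at_top_linorder by blast
qed

end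

section \<open>Identification with the kernel of the theorem\<close>

lemma integrable_vecI:
  fixes f :: "'a \<Rightarrow> real^'n"
  assumes "\<And>j. integrable M (\<lambda>y. f y $ j)"
  shows "integrable M f"
proof -
  have "f = (\<lambda>y. \<Sum>j\<in>UNIV. f y $ j *\<^sub>R axis j 1)"
    by (rule ext) (metis (no_types, lifting) basis_expansion scalar_mult_eq_scaleR sum.cong)
  then show ?thesis
    using assms by (subst \<open>f = _\<close>) (intro Bochner_Integration.integrable_sum integrable_scaleR_left)
qed

context bogovskii begin

text \<open>The scalar factor of the bracketed kernel after
  \<open>\<xi> = dist x y * (1 + t)\<close>. On the diagonal its value is immaterial, since it
  multiplies \<open>x - y\<close>.\<close>

definition k where "k x y = (\<integral>t. indicator {0..} t * ((1 + t) ^ (CARD('n) - 1) * \<psi> (ray t x y)) \<partial>lborel)"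

text \<open>Fubini: integrating the absolute value over \<open>y\<close> first leaves a function of
  \<open>t\<close> below the inverse-square majorant, so the singularity at \<open>y = x\<close> is
  never estimated directly.\<close>

lemma field_integral:
  shows "integrable lborel (\<lambda>y. F y *\<^sub>R (k x y *\<^sub>R (x - y)))"
    and "(\<integral>y. F y *\<^sub>R (k x y *\<^sub>R (x - y)) \<partial>lborel) = (\<chi> j. v j x)"
proof -
  have comp: "(F y *\<^sub>R (k x y *\<^sub>R (x - y))) $ j = (\<integral>t. indicator {0..} t * kU t j x y \<partial>lborel)" for j y
  proof -
    \<comment> \<open>At \<open>y = x\<close> the integral in \<open>k\<close> may diverge, but the
      constant pulled out is then 0.\<close>
    have "indicator {0..} t * kU t j x y = (F y * (x - y) $ j) * (indicator {0..} t * ((1 + t) ^ (CARD('n) - 1) * \<psi> (ray t x y)))" for t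
      by (simp add: kU_def)
    then have "(\<integral>t. indicator {0..} t * kU t j x y \<partial>lborel) = (F y * (x - y) $ j) * k x y"
      unfolding k_def by (simp only: integral_mult_right_zero)
    then show ?thesis by simp
  qed
  have pair: "integrable (lborel \<Otimes>\<^sub>M lborel) (\<lambda>(t, y). indicator {0..} t * kU t j x y)" for j
  proof (rule lborel_pair.Fubini_integrable)
    show "integrable lborel (\<lambda>t. \<integral>y. norm (case (t, y) of (t, y) \<Rightarrow> indicator {0..} t * kU t j x y) \<partial>lborel)"
    proof (rule Bochner_Integration.integrable_bound[OF integrable_inverse_square[of "decay_const (norm x)"]])
      show "AE t in lborel. norm (\<integral>y. norm (case (t, y) of (t, y) \<Rightarrow> indicator {0..} t * kU t j x y) \<partial>lborel)
          \<le> norm (indicator {0..} t * (decay_const (norm x) / (1 + t)\<^sup>2))"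
      proof (rule AE_I2)
        fix t :: real
        show "norm (\<integral>y. norm (case (t, y) of (t, y) \<Rightarrow> indicator {0..} t * kU t j x y) \<partial>lborel)
          \<le> norm (indicator {0..} t * (decay_const (norm x) / (1 + t)\<^sup>2))"
        proof (cases "t \<ge> 0")
          case True
          then show ?thesis
            using order_trans[OF kU_bounds(2)[OF True order_refl, of j x] abs_ge_self] by simp
        qed simp
      qed
    qed measurable
    show "AE t in lborel. integrable lborel (\<lambda>y. case (t, y) of (t, y) \<Rightarrow> indicator {0..} t * kU t j x y)"
    proof (rule AE_I2)
      show "integrable lborel (\<lambda>y. case (t, y) of (t, y) \<Rightarrow> indicator {0..} t * kU t j x y)" for t
        using kU_bounds(1)[OF _ order_refl, of t j x] by (cases "t \<ge> 0") auto
    qed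
  qed measurable
  show int: "integrable lborel (\<lambda>y. F y *\<^sub>R (k x y *\<^sub>R (x - y)))"
    by (rule integrable_vecI) (unfold comp, rule lborel_pair.integrable_snd[OF pair])
  show "(\<integral>y. F y *\<^sub>R (k x y *\<^sub>R (x - y)) \<partial>lborel) = (\<chi> j. v j x)"
  proof (simp only: vec_eq_iff vec_lambda_beta, intro allI)
    fix j
    have "(\<integral>y. F y *\<^sub>R (k x y *\<^sub>R (x - y)) \<partial>lborel) $ j = (\<integral>y. (F y *\<^sub>R (k x y *\<^sub>R (x - y))) $ j \<partial>lborel)"
      using integral_inner_left[OF int, of "axis j 1"] by (simp only: cart_eq_inner_axis)
    also have "\<dots> = (\<integral>y. (\<integral>t. indicator {0..} t * kU t j x y \<partial>lborel) \<partial>lborel)"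
      by (simp only: comp)
    also have "\<dots> = v j x"
      unfolding v_def U_def using lborel_pair.Fubini_integral[OF pair, of j] by simp
    finally show "(\<integral>y. F y *\<^sub>R (k x y *\<^sub>R (x - y)) \<partial>lborel) $ j = v j x" .
  qed
qed

text \<open>The substitution \<open>\<xi> = d + d * t\<close> yields \<open>d\<close> from the
  differential and \<open>d ^ (n - 1)\<close> from the power of \<open>\<xi>\<close>, which together
  cancel the denominator in the theorem. The integral converges because
  \<open>(\<xi> / d) *\<^sub>R (x - y)\<close> has norm \<open>\<bar>\<xi>\<bar>\<close>, which
  bounds \<open>\<xi>\<close> on the support of \<open>\<psi>\<close>.\<close>

lemma radial_integral:
  fixes x y :: "real^'n"
  assumes "x \<noteq> y"
  defines "d \<equiv> dist x y"
  defines "f \<equiv> \<lambda>\<xi>. \<psi> (y + (\<xi> / d) *\<^sub>R (x - y)) * \<xi> ^ (CARD('n) - 1)"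
  shows "f integrable_on {d..}" "integral {d..} f = d ^ CARD('n) * k x y"
proof -
  have d: "d > 0" using assms by simp
  define g where "g \<xi> = indicator {d..} \<xi> *\<^sub>R f \<xi>" for \<xi>
  have [measurable]: "f \<in> borel_measurable borel" unfolding f_def by measurable
  have [measurable]: "g \<in> borel_measurable borel" unfolding g_def by measurable
  let ?R = "r + norm y"
  have supp: "\<bar>\<xi>\<bar> < ?R" if "f \<xi> \<noteq> 0" for \<xi>
  proof -
    have "norm (y + (\<xi> / d) *\<^sub>R (x - y)) < r" using that psi_supp by (auto simp: f_def)
    moreover have "norm ((\<xi> / d) *\<^sub>R (x - y)) = \<bar>\<xi>\<bar>" using d by (simp add: d_def dist_norm)
    ultimately show ?thesis
      using norm_triangle_ineq4[of "y + (\<xi> / d) *\<^sub>R (x - y)" y] by simp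
  qed
  have bd: "norm (g \<xi>) \<le> B * ?R ^ (CARD('n) - 1)" for \<xi>
  proof (cases "f \<xi> = 0")
    case True
    then show ?thesis using B_nonneg r_pos by (simp add: g_def)
  next
    case False
    have "norm (f \<xi>) \<le> B * ?R ^ (CARD('n) - 1)"
      unfolding f_def real_norm_def abs_mult power_abs
      using supp[OF False] psi_bd B_nonneg by (intro mult_mono power_mono) auto
    then show ?thesis using B_nonneg r_pos by (auto simp: g_def indicator_def)
  qed
  have "integrable lborel g"
    by (rule integral_support_bound(1)[OF _ bd, where x = 0 and \<rho> = ?R])
      (use supp r_pos in \<open>auto simp: g_def dist_real_def\<close>)
  then have si: "set_integrable lborel {d..} f" by (simp add: set_integrable_def g_def[abs_def])
  have g_affine: "g (d + d * t) = d ^ (CARD('n) - 1) * (indicator {0..} t * ((1 + t) ^ (CARD('n) - 1) * \<psi> (ray t x y)))" for t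
  proof -
    have "(d + d * t) / d = 1 + t" using d by (simp add: field_simps)
    moreover have "y + (1 + t) *\<^sub>R (x - y) = ray t x y" by (simp add: algebra_simps)
    moreover have "d + d * t = d * (1 + t)" by (simp add: algebra_simps)
    moreover have "indicator {d..} (d + d * t) = (indicator {0..} t :: real)"
      using d by (simp add: indicator_def zero_le_mult_iff)
    ultimately show ?thesis by (simp add: g_def f_def power_mult_distrib)
  qed
  have "integral\<^sup>L lborel g = d *\<^sub>R (\<integral>t. g (d + d *\<^sub>R t) \<partial>lborel)"
    using lborel_integral_affine[of d g d] d by simp
  also have "\<dots> = d * d ^ (CARD('n) - 1) * k x y"
    by (simp add: g_affine k_def)
  also have "d * d ^ (CARD('n) - 1) = d ^ CARD('n)"
    by (metis power_eq_if zero_less_card_finite less_numeral_extra(3))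
  finally have "integral\<^sup>L lborel g = d ^ CARD('n) * k x y" .
  then show "integral {d..} f = d ^ CARD('n) * k x y"
    using set_borel_integral_eq_integral(2)[OF si] by (simp add: set_lebesgue_integral_def g_def[abs_def])
  show "f integrable_on {d..}" by (rule set_borel_integral_eq_integral(1)[OF si])
qed

end

section \<open>The Dini condition\<close>

lemma inverse_not_integrable_at_top:
  fixes a :: real
  assumes "a > 0"
  shows "\<not> (\<lambda>t. 1 / t) integrable_on {a..}"
proof
  assume i: "(\<lambda>t. 1 / t) integrable_on {a..}"
  have bd: "ln s - ln a \<le> integral {a..} (\<lambda>t. 1 / t)" if "s \<ge> a" for s
  proof -
    have h: "((\<lambda>t. 1 / t) has_integral ln s - ln a) {a..s}"
      using assms that
      by (intro fundamental_theorem_of_calculus)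
        (auto intro!: derivative_eq_intros simp: has_real_derivative_iff_has_vector_derivative[symmetric] divide_inverse)
    have "integral {a..s} (\<lambda>t. 1 / t) \<le> integral {a..} (\<lambda>t. 1 / t)"
      by (rule integral_subset_le) (use h i assms in auto)
    then show ?thesis using h by (simp add: integral_unique)
  qed
  define c where "c = integral {a..} (\<lambda>t. 1 / t)"
  have c0: "c \<ge> 0" using bd[of a] by (simp add: c_def)
  \<comment> \<open>This endpoint makes the logarithm exceed the supposed integral \<open>c\<close>
    by exactly 1.\<close>
  have "ln (a * exp (c + 1)) = ln a + (c + 1)" using assms by (simp add: ln_mult)
  moreover have "a * exp (c + 1) \<ge> a" using assms c0 by simp
  ultimately show False using bd[of "a * exp (c + 1)"] by (simp add: c_def)
qed

text \<open>Truncating at \<open>0\<close> and \<open>\<delta>\<close> keeps the modulus monotone, hence Borel, on the whole line: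
  \<open>modulus\<close> is a junk supremum for \<open>\<rho> \<le> 0\<close> and possibly for large \<open>\<rho>\<close>.\<close>

definition truncated_modulus :: "(real^'n) set \<Rightarrow> (real^'n \<Rightarrow> real) \<Rightarrow> real \<Rightarrow> real \<Rightarrow> real" where
  "truncated_modulus \<Omega> F \<delta> \<rho> = (if \<rho> \<le> 0 then 0 else modulus \<Omega> F (min \<rho> \<delta>))"

context
  fixes \<Omega> :: "(real^'n) set" and F :: "real^'n \<Rightarrow> real" and \<delta> :: real and p :: "real^'n"
  assumes p: "p \<in> \<Omega>" and delta: "\<delta> > 0"
    and bdd: "bdd_above {\<bar>F x - F y\<bar> | x y. x \<in> \<Omega> \<and> y \<in> \<Omega> \<and> dist x y < \<delta>}"
    and int: "(\<lambda>\<rho>. modulus \<Omega> F \<rho> / \<rho>) integrable_on {0<..\<delta>}"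
begin

lemma modulus_bdd:
  "\<rho> \<le> \<delta> \<Longrightarrow> bdd_above {\<bar>F x - F y\<bar> | x y. x \<in> \<Omega> \<and> y \<in> \<Omega> \<and> dist x y < \<rho>}"
  by (rule bdd_above_mono[OF bdd]) force

lemma truncated_modulus_osc:
  assumes "x \<in> \<Omega>" "y \<in> \<Omega>" "dist x y < \<rho>" "\<rho> \<le> \<delta>"
  shows "\<bar>F x - F y\<bar> \<le> truncated_modulus \<Omega> F \<delta> \<rho>"
proof -
  have "\<rho> > 0" using assms(3) zero_le_dist[of x y] by linarith
  then show ?thesis
    unfolding truncated_modulus_def modulus_def using assms by (auto intro!: cSup_upper modulus_bdd)
qed

text \<open>The pair \<open>p\<close>, \<open>p\<close> puts 0 into the set of oscillations, so for
  positive \<open>\<rho>\<close> the supremum is over a nonempty set and at least 0.\<close>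

lemma truncated_modulus_nonneg: "truncated_modulus \<Omega> F \<delta> \<rho> \<ge> 0"
proof (cases "\<rho> \<le> 0")
  case False
  then have "truncated_modulus \<Omega> F \<delta> \<rho> = truncated_modulus \<Omega> F \<delta> (min \<rho> \<delta>)" using delta by (auto simp: truncated_modulus_def)
  then show ?thesis using truncated_modulus_osc[OF p p, of "min \<rho> \<delta>"] False delta by simp
qed (simp add: truncated_modulus_def)

lemma truncated_modulus_mono: "mono (truncated_modulus \<Omega> F \<delta>)"
proof (rule monoI)
  fix a b :: real assume ab: "a \<le> b"
  show "truncated_modulus \<Omega> F \<delta> a \<le> truncated_modulus \<Omega> F \<delta> b"
  proof (cases "a \<le> 0")
    case True
    then show ?thesis using truncated_modulus_nonneg[of b] by (simp add: truncated_modulus_def)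
  next
    case False
    have "modulus \<Omega> F (min a \<delta>) \<le> modulus \<Omega> F (min b \<delta>)"
      unfolding modulus_def
    proof (rule cSup_subset_mono)
      have "\<bar>F p - F p\<bar> \<in> {\<bar>F x - F y\<bar> | x y. x \<in> \<Omega> \<and> y \<in> \<Omega> \<and> dist x y < min a \<delta>}"
        using p False delta by (intro CollectI exI[of _ p] conjI refl) auto
      then show "{\<bar>F x - F y\<bar> | x y. x \<in> \<Omega> \<and> y \<in> \<Omega> \<and> dist x y < min a \<delta>} \<noteq> {}" by blast
      show "bdd_above {\<bar>F x - F y\<bar> | x y. x \<in> \<Omega> \<and> y \<in> \<Omega> \<and> dist x y < min b \<delta>}"
        by (rule modulus_bdd) simp
    qed (use ab in force)
    then show ?thesis using False ab by (simp add: truncated_modulus_def)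
  qed
qed

text \<open>The map \<open>t\<close> to \<open>M / t\<close> carries \<open>{M / \<delta>..}\<close>
  onto \<open>{0<..\<delta>}\<close>, and its Jacobian \<open>M / t\<^sup>2\<close> divided by
  \<open>\<rho> = M / t\<close> is \<open>1 / t\<close>.\<close>

lemma truncated_modulus_dini:
  assumes M: "M > 0"
  shows "integrable lborel (\<lambda>t. indicator {M / \<delta>..} t * (truncated_modulus \<Omega> F \<delta> (M / t) / t))"
proof -
  have [measurable]: "truncated_modulus \<Omega> F \<delta> \<in> borel_measurable borel" by (rule borel_measurable_mono[OF truncated_modulus_mono])
  have "(\<lambda>\<rho>. truncated_modulus \<Omega> F \<delta> \<rho> / \<rho>) integrable_on {0<..\<delta>}"
    by (rule integrable_eq[OF int]) (simp add: truncated_modulus_def)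
  \<comment> \<open>The Dini condition is a gauge integral; nonnegativity upgrades it to the
    absolute integrability that the change of variables preserves.\<close>
  then have ai: "(\<lambda>\<rho>. truncated_modulus \<Omega> F \<delta> \<rho> / \<rho>) absolutely_integrable_on {0<..\<delta>}"
    by (rule nonnegative_absolutely_integrable_1) (simp add: truncated_modulus_nonneg)
  have Md: "M / \<delta> > 0" using M delta by simp
  have img: "(\<lambda>t. M / t) ` {M / \<delta>..} = {0<..\<delta>}"
  proof (intro equalityI subsetI)
    fix \<rho> assume "\<rho> \<in> {0<..\<delta>}"
    then show "\<rho> \<in> (\<lambda>t. M / t) ` {M / \<delta>..}"
      using M delta by (intro image_eqI[of _ _ "M / \<rho>"]) (auto simp: field_simps)
  next
    fix \<rho> assume "\<rho> \<in> (\<lambda>t. M / t) ` {M / \<delta>..}"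
    then obtain t where t: "t \<ge> M / \<delta>" "\<rho> = M / t" by auto
    then have "t > 0" using Md by linarith
    then show "\<rho> \<in> {0<..\<delta>}"
      using t(1) M delta by (simp add: t(2) divide_le_eq mult.commute)
  qed
  have "(\<lambda>t. \<bar>- M / t\<^sup>2\<bar> * (truncated_modulus \<Omega> F \<delta> (M / t) / (M / t))) absolutely_integrable_on {M / \<delta>..}"
  proof (subst absolutely_integrable_change_of_variables_1'[symmetric, where g = "\<lambda>t. M / t"])
    show "((\<lambda>t. M / t) has_field_derivative - M / t\<^sup>2) (at t within {M / \<delta>..})" if "t \<in> {M / \<delta>..}" for t
    proof -
      have "t \<noteq> 0" using that Md by auto
      then show ?thesis by (auto intro!: derivative_eq_intros simp: power2_eq_square)
    qed
    show "inj_on (\<lambda>t. M / t) {M / \<delta>..}" using Md M by (auto simp: inj_on_def field_simps)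
    show "(\<lambda>\<rho>. truncated_modulus \<Omega> F \<delta> \<rho> / \<rho>) absolutely_integrable_on (\<lambda>t. M / t) ` {M / \<delta>..}"
      unfolding img by (rule ai)
  qed auto
  moreover have "indicator {M / \<delta>..} t *\<^sub>R (\<bar>- M / t\<^sup>2\<bar> * (truncated_modulus \<Omega> F \<delta> (M / t) / (M / t)))
      = indicator {M / \<delta>..} t * (truncated_modulus \<Omega> F \<delta> (M / t) / t)" for t
  proof (cases "t \<ge> M / \<delta>")
    case True
    then have "t > 0" using Md by linarith
    then show ?thesis using M by (simp add: power2_eq_square)
  qed simp
  ultimately have "integrable lebesgue (\<lambda>t. indicator {M / \<delta>..} t * (truncated_modulus \<Omega> F \<delta> (M / t) / t))"
    by (simp only: set_integrable_def)
  then show ?thesis by (subst (asm) integrable_completion) measurable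
qed

text \<open>Were the modulus at least \<open>c\<close> at all small scales, the Dini integrand would
  dominate \<open>c / t\<close> near infinity, contradicting the divergence of the
  logarithm.\<close>

lemma truncated_modulus_small:
  assumes "c > 0"
  shows "\<exists>\<rho>. 0 < \<rho> \<and> \<rho> \<le> \<delta> \<and> truncated_modulus \<Omega> F \<delta> \<rho> < c"
proof (rule ccontr)
  assume *: "\<not> (\<exists>\<rho>. 0 < \<rho> \<and> \<rho> \<le> \<delta> \<and> truncated_modulus \<Omega> F \<delta> \<rho> < c)"
  have big: "truncated_modulus \<Omega> F \<delta> \<rho> \<ge> c" if "0 < \<rho>" "\<rho> \<le> \<delta>" for \<rho> using * that by force
  have d: "1 / \<delta> > 0" using delta by simp
  have "integrable lborel (\<lambda>t. indicator {1 / \<delta>..} t *\<^sub>R (1 / t))"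
  proof (rule Bochner_Integration.integrable_bound)
    show "integrable lborel (\<lambda>t. (1 / c) * (indicator {1 / \<delta>..} t * (truncated_modulus \<Omega> F \<delta> (1 / t) / t)))"
      by (rule integrable_mult_right[OF truncated_modulus_dini]) simp
    show "AE t in lborel. norm (indicator {1 / \<delta>..} t *\<^sub>R (1 / t))
        \<le> norm ((1 / c) * (indicator {1 / \<delta>..} t * (truncated_modulus \<Omega> F \<delta> (1 / t) / t)))"
    proof (rule AE_I2)
      fix t
      show "norm (indicator {1 / \<delta>..} t *\<^sub>R (1 / t))
        \<le> norm ((1 / c) * (indicator {1 / \<delta>..} t * (truncated_modulus \<Omega> F \<delta> (1 / t) / t)))"
      proof (cases "t \<ge> 1 / \<delta>")
        case True
        then have t: "t > 0" using d by linarith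
        have "truncated_modulus \<Omega> F \<delta> (1 / t) \<ge> c" using t True delta by (intro big) (auto simp: field_simps)
        then show ?thesis using True t assms by (simp add: field_simps)
      qed simp
    qed
  qed measurable
  then have "(\<lambda>t. 1 / t) integrable_on {1 / \<delta>..}"
    by (intro set_borel_integral_eq_integral(1)) (simp add: set_integrable_def)
  then show False using inverse_not_integrable_at_top[OF d] by blast
qed

text \<open>On a bounded domain this makes \<open>F\<close> bounded, and it makes the extension by 0
  Borel measurable.\<close>

lemma dini_uniformly_continuous: "uniformly_continuous_on \<Omega> F"
  unfolding uniformly_continuous_on_def
proof (intro allI impI)
  fix \<epsilon> :: real assume "\<epsilon> > 0"
  then obtain \<rho> where r: "0 < \<rho>" "\<rho> \<le> \<delta>" "truncated_modulus \<Omega> F \<delta> \<rho> < \<epsilon>" using truncated_modulus_small by blast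
  have "dist (F y) (F x) < \<epsilon>" if "x \<in> \<Omega>" "y \<in> \<Omega>" "dist y x < \<rho>" for x y
    using truncated_modulus_osc[OF that(2,1,3) r(2)] r(3) by (simp add: dist_real_def)
  then show "\<exists>d>0. \<forall>x\<in>\<Omega>. \<forall>y\<in>\<Omega>. dist y x < d \<longrightarrow> dist (F y) (F x) < \<epsilon>" using r(1) by blast
qed

end

section \<open>The given data as an instance of the construction\<close>

lemma smooth_gradient:
  fixes \<psi> :: "real^'n \<Rightarrow> real"
  assumes "smooth_Rn \<psi>"
  defines "P \<equiv> \<lambda>x. \<chi> i. partial_deriv i \<psi> x"
  shows "(\<psi> has_derivative (\<lambda>h. h \<bullet> P x)) (at x)" "continuous_on UNIV P"
    "P x \<noteq> 0 \<Longrightarrow> x \<in> tsupp \<psi>"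
proof -
  have "iter_partial [] \<psi> differentiable_on UNIV" using assms(1) unfolding smooth_Rn_def by blast
  then have D: "(\<psi> has_derivative frechet_derivative \<psi> (at x)) (at x)" for x
    by (simp add: differentiable_on_def frechet_derivative_works[symmetric])
  have "frechet_derivative \<psi> (at x) h = h \<bullet> P x" for x h
  proof -
    interpret linear "frechet_derivative \<psi> (at x)" using D has_derivative_linear by blast
    have "h = (\<Sum>i\<in>UNIV. h $ i *\<^sub>R axis i 1)" using basis_expansion[of h] by (simp add: scalar_mult_eq_scaleR)
    then have "frechet_derivative \<psi> (at x) h = (\<Sum>i\<in>UNIV. h $ i *\<^sub>R frechet_derivative \<psi> (at x) (axis i 1))"
      by (metis (no_types, lifting) scale sum sum.cong)
    then show ?thesis by (simp add: P_def inner_vec_def partial_deriv_def)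
  qed
  with D show g: "(\<psi> has_derivative (\<lambda>h. h \<bullet> P x)) (at x)" for x by (metis (no_types, lifting) ext)
  have "partial_deriv i \<psi> differentiable_on UNIV" for i
  proof -
    have "iter_partial [i] \<psi> differentiable_on UNIV" using assms(1) unfolding smooth_Rn_def by blast
    then show ?thesis by simp
  qed
  then show "continuous_on UNIV P"
    unfolding P_def by (intro continuous_on_vec_lambda differentiable_imp_continuous_on)
  show "x \<in> tsupp \<psi>" if "P x \<noteq> 0"
  proof (rule ccontr)
    assume x: "x \<notin> tsupp \<psi>"
    \<comment> \<open>Off the closed support \<open>\<psi>\<close> vanishes on a neighbourhood, so
      uniqueness of the derivative forces the gradient to be 0.\<close>
    have "((\<lambda>_. 0) has_derivative (\<lambda>h. h \<bullet> P x)) (at x)"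
    proof (rule has_derivative_transform_within_open[OF g])
      show "open (- tsupp \<psi>)" by (simp add: tsupp_def open_Compl)
      show "\<psi> z = 0" if "z \<in> - tsupp \<psi>" for z
        using that closure_subset[of "{x. \<psi> x \<noteq> 0}"] by (auto simp: tsupp_def)
    qed (use x in auto)
    then have "(\<lambda>h. h \<bullet> P x) = (\<lambda>h. 0)" using has_derivative_const has_derivative_unique by blast
    then have "P x \<bullet> P x = 0" by meson
    with that show False by simp
  qed
qed

theorem theorem14:
  fixes x0 :: "real^'n" and R :: real
    and \<psi> :: "real^'n \<Rightarrow> real" and \<Omega> :: "(real^'n) set" and F :: "real^'n \<Rightarrow> real"
  assumes n2: "CARD('n) \<ge> 2"
    and psi_smooth: "smooth_Rn \<psi>"
    and psi_supp: "tsupp \<psi> \<subseteq> ball x0 R"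
    and psi_int: "integral UNIV \<psi> = 1"
    and Omega_open: "open \<Omega>" and Omega_bdd: "bounded \<Omega>"
    and star: "\<forall>p\<in>cball x0 R. star_shaped_wrt \<Omega> p"
    and F_dini: "dini_continuous \<Omega> F"
    and F_int: "integral \<Omega> F = 0"
  shows "let n = CARD('n);
             K = (\<lambda>x y. (integral {dist x y..}
                    (\<lambda>\<xi>. \<psi> (y + (\<xi> / dist x y) *\<^sub>R (x - y)) * \<xi> ^ (n - 1))
                    / dist x y ^ n) *\<^sub>R (x - y));
             v = (\<lambda>x. integral \<Omega> (\<lambda>y. F y *\<^sub>R K x y))
         in (\<forall>x y. x \<noteq> y \<longrightarrow>
                (\<lambda>\<xi>. \<psi> (y + (\<xi> / dist x y) *\<^sub>R (x - y)) * \<xi> ^ (n - 1)) integrable_on {dist x y..})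
          \<and> (\<forall>x. (\<lambda>y. F y *\<^sub>R K x y) integrable_on \<Omega>)
          \<and> v differentiable_on \<Omega>
          \<and> (\<forall>i j. continuous_on \<Omega> (\<lambda>x. frechet_derivative v (at x) (axis i 1) $ j))
          \<and> continuous_on UNIV v
          \<and> (\<forall>x\<in>\<Omega>. divergence v x = F x)
          \<and> (\<forall>x. x \<notin> \<Omega> \<longrightarrow> v x = 0)"
proof -
  define P where "P x = (\<chi> i. partial_deriv i \<psi> x)" for x
  note grad = smooth_gradient[OF psi_smooth, folded P_def]
  have psi_cont: "continuous_on UNIV \<psi>"
    by (simp add: continuous_at_imp_continuous_on has_derivative_continuous[OF grad(1)])
  have psi_t: "x \<in> tsupp \<psi>" if "\<psi> x \<noteq> 0" for x
    using that closure_subset[of "{x. \<psi> x \<noteq> 0}"] by (auto simp: tsupp_def)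
  have psi_ball: "x \<in> ball x0 R" if "\<psi> x \<noteq> 0" for x
    using psi_t[OF that] psi_supp by blast
  \<comment> \<open>Unit mass makes the ball nonempty, which excludes a nonpositive
    \<open>R\<close>; then the star condition at \<open>x0\<close> is not vacuous and puts
    \<open>x0\<close> into the domain.\<close>
  have "\<exists>x. \<psi> x \<noteq> 0"
  proof (rule ccontr)
    assume "\<not> (\<exists>x. \<psi> x \<noteq> 0)"
    then have "\<psi> = (\<lambda>x. 0)" by auto
    with psi_int show False by simp
  qed
  then obtain z where "\<psi> z \<noteq> 0" by blast
  then have "z \<in> ball x0 R" by (rule psi_ball)
  then have "x0 \<in> cball x0 R" by (simp add: order_trans[OF zero_le_dist less_imp_le])
  then have x0: "x0 \<in> \<Omega>" using star unfolding star_shaped_wrt_def by blast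
  obtain \<delta> where delta: "\<delta> > 0"
    and bdd: "bdd_above {\<bar>F x - F y\<bar> | x y. x \<in> \<Omega> \<and> y \<in> \<Omega> \<and> dist x y < \<delta>}"
    and mint: "(\<lambda>\<rho>. modulus \<Omega> F \<rho> / \<rho>) integrable_on {0<..\<delta>}"
    using F_dini unfolding dini_continuous_def by blast
  note data = x0 delta bdd mint
  have F_uc: "uniformly_continuous_on \<Omega> F" by (rule dini_uniformly_continuous[OF data])
  define Fe where "Fe y = indicator \<Omega> y * F y" for y
  have "bounded (F ` \<Omega>)" by (rule bounded_uniformly_continuous_image[OF F_uc Omega_bdd])
  then obtain b1 where b1: "\<And>y. y \<in> \<Omega> \<Longrightarrow> \<bar>F y\<bar> \<le> b1" by (auto simp: bounded_iff)
  have "bounded (\<Omega> \<union> ball x0 R)" using Omega_bdd by simp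
  then obtain r0 where r0: "\<And>y. y \<in> \<Omega> \<Longrightarrow> norm y \<le> r0" "\<And>y. y \<in> ball x0 R \<Longrightarrow> norm y \<le> r0"
    unfolding bounded_iff by blast
  \<comment> \<open>Positive even for negative \<open>r0\<close>, and strictly above the norms of
    all points of the domain and of the ball.\<close>
  define r where "r = \<bar>r0\<bar> + 1"
  have supp_psi: "norm x < r" if "\<psi> x \<noteq> 0" for x
  proof -
    have "norm x \<le> r0" using psi_t[OF that] psi_supp r0(2) by blast
    then show ?thesis by (simp add: r_def)
  qed
  have supp_P: "norm x < r" if "P x \<noteq> 0" for x
  proof -
    have "norm x \<le> r0" using grad(3)[OF that] psi_supp r0(2) by blast
    then show ?thesis by (simp add: r_def)
  qed
  obtain b2 where b2: "b2 \<ge> 0" "\<And>x. norm (\<psi> x) \<le> b2"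
    using compact_support_bounded[OF psi_cont supp_psi] by blast
  obtain b3 where b3: "b3 \<ge> 0" "\<And>x. norm (P x) \<le> b3"
    using compact_support_bounded[OF grad(2) supp_P] by blast
  define B where "B = max \<bar>b1\<bar> (max b2 b3)"
  have F_cont: "continuous_on \<Omega> F" using F_uc by (rule uniformly_continuous_imp_continuous)
  have Fe_meas: "Fe \<in> borel_measurable borel"
    using borel_measurable_continuous_on_indicator[OF borel_open[OF Omega_open] F_cont]
    by (simp add: Fe_def[abs_def])
  have Fe_bd: "\<bar>Fe x\<bar> \<le> B" for x
  proof (cases "x \<in> \<Omega>")
    case True
    then show ?thesis using b1[OF True] by (simp add: Fe_def B_def)
  next
    case False
    then show ?thesis using b2(1) by (simp add: Fe_def B_def)
  qed
  have Fe_supp: "norm x < r" if "Fe x \<noteq> 0" for x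
  proof -
    have "x \<in> \<Omega>" using that by (auto simp: Fe_def indicator_def)
    then show ?thesis using r0(1)[of x] by (simp add: r_def)
  qed
  have rpos: "r > 0" by (simp add: r_def)
  interpret bogovskii \<psi> P Fe r B
  proof
    show "\<bar>\<psi> x\<bar> \<le> B" for x using b2(2)[of x] by (simp add: B_def)
    show "norm (P x) \<le> B" for x using b3(2)[of x] by (simp add: B_def)
  qed (fact grad(1) grad(2) supp_psi supp_P Fe_supp Fe_bd Fe_meas rpos)+
  \<comment> \<open>The normalisations of \<open>\<psi>\<close> and \<open>F\<close> are given as
    gauge integrals; Lebesgue integrability allows them to be read as Bochner integrals.\<close>
  have Fe_int: "integrable lborel Fe"
    by (rule integral_support_bound(1)[OF Fe_meas, where C = B and x = 0 and \<rho> = r])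
      (use Fe_bd Fe_supp rpos in auto)
  have psi_i: "integrable lborel \<psi>"
    by (rule integral_support_bound(1)[OF psi_meas, where C = B and x = 0 and \<rho> = r])
      (use psi_bd supp_psi rpos in auto)
  have Fe_si: "set_integrable lborel \<Omega> F" using Fe_int by (simp add: set_integrable_def Fe_def[abs_def])
  interpret bogovskii_dini \<psi> P Fe r B \<Omega> "truncated_modulus \<Omega> F \<delta>" \<delta>
  proof
    show "continuous_on \<Omega> Fe"
      by (rule continuous_on_eq[OF F_cont]) (simp add: Fe_def)
    show "\<bar>Fe x - Fe y\<bar> \<le> truncated_modulus \<Omega> F \<delta> \<rho>"
      if "x \<in> \<Omega>" "y \<in> \<Omega>" "dist x y < \<rho>" "\<rho> \<le> \<delta>" for x y \<rho>
      using truncated_modulus_osc[OF data that] that by (simp add: Fe_def)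
    show "integral\<^sup>L lborel \<psi> = 1" using integral_lborel[OF psi_i] psi_int by simp
    show "integral\<^sup>L lborel Fe = 0"
      using set_borel_integral_eq_integral(2)[OF Fe_si] F_int
      by (simp add: set_lebesgue_integral_def Fe_def[abs_def])
  qed (fact Omega_open delta truncated_modulus_dini[OF data])+
  define K where "K x y = (integral {dist x y..}
                    (\<lambda>\<xi>. \<psi> (y + (\<xi> / dist x y) *\<^sub>R (x - y)) * \<xi> ^ (CARD('n) - 1))
                    / dist x y ^ CARD('n)) *\<^sub>R (x - y)" for x y :: "real^'n"
  define V where "V x = (\<chi> j. v j x)" for x
  \<comment> \<open>For \<open>x = y\<close> both sides are 0 through the factor
    \<open>x - y\<close>, whatever the quotient by 0 evaluates to.\<close>
  have K: "K x y = k x y *\<^sub>R (x - y)" for x y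
    unfolding K_def using radial_integral(2)[of x y] by (cases "x = y") simp_all
  have ind: "indicator \<Omega> y *\<^sub>R (F y *\<^sub>R K x y) = Fe y *\<^sub>R (k x y *\<^sub>R (x - y))" for x y
    by (simp add: Fe_def K)
  have si: "set_integrable lborel \<Omega> (\<lambda>y. F y *\<^sub>R K x y)" for x
    unfolding set_integrable_def ind by (rule field_integral(1))
  have V: "integral \<Omega> (\<lambda>y. F y *\<^sub>R K x y) = V x" for x
    using set_borel_integral_eq_integral(2)[OF si[of x]] field_integral(2)[of x]
    unfolding set_lebesgue_integral_def ind V_def by simp
  have V_deriv: "(V has_derivative (\<lambda>h. \<chi> j. h \<bullet> Gv j x)) (at x)" if "x \<in> \<Omega>" for x
  proof (rule iffD2[OF has_derivative_componentwise_within], rule ballI)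
    fix i :: "real^'n" assume "i \<in> Basis"
    then obtain j where i: "i = axis j 1" by (auto simp: Basis_vec_def)
    show "((\<lambda>x. V x \<bullet> i) has_derivative (\<lambda>h. (\<chi> j. h \<bullet> Gv j x) \<bullet> i)) (at x)"
      using v_derivative[OF that, of j] by (simp add: i V_def inner_axis)
  qed
  have fd: "frechet_derivative V (at x) (axis i 1) $ j = Gv j x $ i" if "x \<in> \<Omega>" for x i j
    by (simp add: frechet_derivative_at[OF V_deriv[OF that], symmetric] inner_axis')
  \<comment> \<open>For \<open>y\<close> in the domain, \<open>x\<close> lies on the segment from
    \<open>ray t x y\<close> to \<open>y\<close>, with weights \<open>1 / (1 + t)\<close> and
    \<open>t / (1 + t)\<close>. If \<open>\<psi>\<close> were nonzero at the ray point, that point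
    would lie in the ball and star-shapedness would put \<open>x\<close> into the domain; hence the
    kernel itself vanishes.\<close>
  have V_out: "V x = 0" if x: "x \<notin> \<Omega>" for x
  proof -
    have "F y *\<^sub>R K x y = 0" if y: "y \<in> \<Omega>" for y
    proof -
      have "indicator {0..} t * ((1 + t) ^ (CARD('n) - 1) * \<psi> (ray t x y)) = 0" for t
      proof (cases "t \<ge> 0 \<and> \<psi> (ray t x y) \<noteq> 0")
        case True
        then have "ray t x y \<in> cball x0 R" using psi_ball[of "ray t x y"] by auto
        then have "closed_segment (ray t x y) y \<subseteq> \<Omega>" using star y unfolding star_shaped_wrt_def by blast
        moreover have "x \<in> closed_segment (ray t x y) y"
          unfolding in_segment
        proof (intro exI[of _ "t / (1 + t)"] conjI)
          have t: "1 + t \<noteq> 0" using True by linarith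
          have c: "1 - t / (1 + t) = 1 / (1 + t)" using t by (simp add: field_simps)
          have "(1 + t) *\<^sub>R x = ray t x y + t *\<^sub>R y" by (simp add: algebra_simps)
          then have "x = (1 / (1 + t)) *\<^sub>R (ray t x y + t *\<^sub>R y)" using t by (metis divide_self_if scaleR_one scaleR_scaleR times_divide_eq_left mult_1)
          then show "x = (1 - t / (1 + t)) *\<^sub>R ray t x y + (t / (1 + t)) *\<^sub>R y"
            unfolding c by (simp only: scaleR_add_right scaleR_scaleR times_divide_eq_left mult_1)
        qed (use True in auto)
        ultimately show ?thesis using x by blast
      qed auto
      then show ?thesis unfolding K k_def by (simp only:) simp
    qed
    then have "integral \<Omega> (\<lambda>y. F y *\<^sub>R K x y) = integral \<Omega> (\<lambda>y. 0)" by (rule integral_cong)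
    then show ?thesis by (simp add: V)
  qed
  have "V differentiable_on \<Omega>"
    using V_deriv by (auto simp: differentiable_on_def differentiable_def intro: has_derivative_at_withinI)
  moreover have "continuous_on \<Omega> (\<lambda>x. frechet_derivative V (at x) (axis i 1) $ j)" for i j
    by (rule continuous_on_eq[where f = "\<lambda>x. Gv j x $ i"]) (auto intro: continuous_on_component Gv_continuous simp: fd)
  moreover have "continuous_on UNIV V"
    unfolding V_def[abs_def] by (intro continuous_on_vec_lambda v_continuous)
  moreover have "divergence V x = F x" if "x \<in> \<Omega>" for x
    using divergence_Gv[OF that] that by (simp add: divergence_def fd Fe_def)
  moreover have "(\<lambda>y. F y *\<^sub>R K x y) integrable_on \<Omega>" for x
    by (rule set_borel_integral_eq_integral(1)[OF si])
  ultimately show ?thesis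
    unfolding Let_def K_def[symmetric] V
    by (intro conjI allI impI ballI radial_integral(1) V_out) simp_all
qed

end
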